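(* Let $\mathcal{C}$ be a toric constellation of dimension $d\ge2$, let $Q\in\mathcal{C}$, and let $Q(a_1,\dots,a_k)\in\mathcal{C}$ ($k\ge1$, $1\le a_i\le d$) be the point of $\mathcal{C}$ reached from $Q$ by the code $(a_1,\dots,a_k)$. Then $Q(a_1,\dots,a_k)$ is proximate to $Q$ if and only if $a_1\neq a_j$ for all $2\le j\le k$.
   Context: Toric constellations: let $N\cong\mathbb{Z}^d$, $d\ge2$, with ordered basis $\mathcal{B}=(v_1,\dots,v_d)$, $\Delta=\langle\mathcal{B}\rangle$ the cone it generates in $N\otimes\mathbb{R}$, and $X_0\cong\mathbb{K}^d$ the associated affine toric variety with torus $T$. A toric constellation is a set $\mathcal{C}=\{Q_0,\dots,Q_n\}$ where $Q_0$ is the $T$-fixed point of $X_0$, and $Q_i$ is a $T$-fixed point of $X_i:=\mathrm{Bl}_{Q_{i-1}}X_{i-1}$ mapping to $Q_0$, for $1\le i\le n$. Write $Q_j\ge Q_i$ if $Q_i$ is the image of $Q_j$. Let $B_i\subset X_{i+1}$ be the exceptional divisor of the blowing-up at $Q_i$ and $E_i$ its strict transforms on later $X_j$. A point $Q_j\ge Q_i$, $j>i$, is proximate to $Q_i$ if $Q_j\in E_i$ in $X_j$. Coding: fixed points correspond to maximal cones with ordered bases. $Q_0$ corresponds to $\mathcal{B}$. If a point $Q$ corresponds to the maximal cone spanned by an ordered basis $(w_1,\dots,w_d)$ of $N$, the blowing-up of $Q$ replaces this cone by the $d$ cones $\Delta_i$ spanned by the ordered bases obtained by replacing $w_i$ by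 $w_1+\dots+w_d$ (in position $i$), $1\le i\le d$; the fixed point corresponding to $\Delta_a$ is denoted $Q(a)$. Inductively, $Q(a_1,\dots,a_k):=\bigl(Q(a_1,\dots,a_{k-1})\bigr)(a_k)$. *)

theory Defs
  imports "HOL-Analysis.Finite_Cartesian_Product" "HOL-Library.Poly_Mapping"
begin

text \<open>
  Both lattices \<open>N\<close> and \<open>M = Hom(N, \<int>)\<close> are \<open>int ^ 'd\<close>, with \<open>pairing\<close> the duality between them.
  An ordered basis of \<open>N\<close> is a family \<open>'d \<Rightarrow> int ^ 'd\<close>. Only regular cones occur: such a cone is given
  by the set \<open>G\<close> of its generators, and its faces are given by the subsets of \<open>G\<close>.
  A fan whose maximal cones are full-dimensional is given by the set of ordered bases
  spanning its maximal cones.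
\<close>

definition pairing :: "int ^ 'd::finite \<Rightarrow> int ^ 'd \<Rightarrow> int" where
  "pairing m u = (\<Sum>i\<in>UNIV. m $ i * u $ i)"

definition lattice_basis :: "('d::finite \<Rightarrow> int ^ 'd) \<Rightarrow> bool" where
  "lattice_basis v \<longleftrightarrow> (\<forall>x. \<exists>!c :: 'd \<Rightarrow> int. x = (\<Sum>i\<in>UNIV. c i *s v i))"

definition dual_monoid :: "(int ^ 'd::finite) set \<Rightarrow> (int ^ 'd) set" where
  "dual_monoid G = {m. \<forall>u\<in>G. 0 \<le> pairing m u}"

definition cones :: "('d::finite \<Rightarrow> int ^ 'd) set \<Rightarrow> (int ^ 'd) set set" where
  "cones F = {G. \<exists>w\<in>F. G \<subseteq> range w}"


section \<open>Points of a toric variety\<close>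

text \<open>
  The points of the affine toric variety \<open>U\<^sub>\<sigma> = Spec K[\<sigma>\<^sup>\<or> \<inter> M]\<close> are the monoid homomorphisms
  from \<open>\<sigma>\<^sup>\<or> \<inter> M\<close> to the multiplicative monoid of \<open>K\<close>. They are encoded as partial functions on \<open>M\<close>
  with domain \<open>\<sigma>\<^sup>\<or> \<inter> M\<close>.
\<close>

type_synonym ('d, 'k) tpoint = "int ^ 'd \<Rightarrow> 'k option"

definition monoid_homs :: "(int ^ 'd::finite) set \<Rightarrow> ('d, 'k::field) tpoint set" where
  "monoid_homs S = {x. dom x = S \<and> x 0 = Some 1 \<and>
     (\<forall>m\<in>S. \<forall>m'\<in>S. x (m + m') = Some (the (x m) * the (x m')))}"

definition local_points :: "('d::finite \<Rightarrow> int ^ 'd) set \<Rightarrow> ('d, 'k::field) tpoint set" where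
  "local_points F = (\<Union>G\<in>cones F. monoid_homs (dual_monoid G))"

text \<open>
  For a face \<open>\<tau>\<close> of \<open>\<sigma>\<close> the open inclusion of \<open>U\<^sub>\<tau>\<close> in \<open>U\<^sub>\<sigma>\<close> is restriction of homomorphisms from
  \<open>\<tau>\<^sup>\<or> \<inter> M\<close> to \<open>\<sigma>\<^sup>\<or> \<inter> M\<close>, and the variety is obtained by gluing along these inclusions: a point of
  \<open>U\<^sub>\<sigma>\<close> is identified with a point of \<open>U\<^sub>\<sigma>\<^sub>'\<close> iff they have a common extension to a point of some
  \<open>U\<^sub>\<tau>\<close>. Each class has a greatest element for extension, its member on the smallest
  \<open>U\<^sub>\<tau>\<close> containing the point; these maximal elements are taken as the points of the variety.
\<close>

definition toric_variety :: "('d::finite \<Rightarrow> int ^ 'd) set \<Rightarrow> ('d, 'k::field) tpoint set" where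
  "toric_variety F = {x \<in> local_points F. \<forall>y \<in> local_points F. x \<subseteq>\<^sub>m y \<longrightarrow> y = x}"

definition chart :: "('d::finite \<Rightarrow> int ^ 'd) set \<Rightarrow> ('d \<Rightarrow> int ^ 'd) \<Rightarrow> ('d, 'k::field) tpoint set" where
  "chart F w = {x \<in> toric_variety F. dual_monoid (range w) \<subseteq> dom x}"

text \<open>
  A regular function on \<open>U\<^sub>\<sigma>\<close> is an element of the monoid algebra \<open>K[\<sigma>\<^sup>\<or> \<inter> M]\<close>.
\<close>

definition eval_regular :: "((int ^ 'd::finite) \<Rightarrow>\<^sub>0 'k::field) \<Rightarrow> ('d, 'k) tpoint \<Rightarrow> 'k" where
  "eval_regular f x = (\<Sum>m\<in>Poly_Mapping.keys f. Poly_Mapping.lookup f m * the (x m))"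

definition zariski_closed ::
  "('d::finite \<Rightarrow> int ^ 'd) set \<Rightarrow> ('d, 'k::field) tpoint set \<Rightarrow> bool" where
  "zariski_closed F Z \<longleftrightarrow> Z \<subseteq> toric_variety F \<and>
     (\<forall>w\<in>F. \<exists>I. (\<forall>f\<in>I. Poly_Mapping.keys f \<subseteq> dual_monoid (range w)) \<and>
        Z \<inter> chart F w = {x \<in> chart F w. \<forall>f\<in>I. eval_regular f x = 0})"

definition zariski_closure ::
  "('d::finite \<Rightarrow> int ^ 'd) set \<Rightarrow> ('d, 'k::field) tpoint set \<Rightarrow> ('d, 'k) tpoint set" where
  "zariski_closure F A = \<Inter>{Z. zariski_closed F Z \<and> A \<subseteq> Z}"

definition torus :: "(int ^ 'd::finite \<Rightarrow> 'k::field) set" where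
  "torus = {t. (\<forall>m. t m \<noteq> 0) \<and> (\<forall>m m'. t (m + m') = t m * t m')}"

definition torus_act ::
  "(int ^ 'd::finite \<Rightarrow> 'k::field) \<Rightarrow> ('d, 'k) tpoint \<Rightarrow> ('d, 'k) tpoint" where
  "torus_act t x = (\<lambda>m. map_option (\<lambda>c. t m * c) (x m))"

definition torus_fixed ::
  "('d::finite \<Rightarrow> int ^ 'd) set \<Rightarrow> ('d, 'k::field) tpoint \<Rightarrow> bool" where
  "torus_fixed F x \<longleftrightarrow> x \<in> toric_variety F \<and> (\<forall>t\<in>torus. torus_act t x = x)"

text \<open>
  The morphism of toric varieties induced by the identity of \<open>N\<close>, for a source fan refining the
  target fan \<open>F\<close>: a point \<open>x\<close> is restricted to \<open>\<sigma>\<^sup>\<or> \<inter> M\<close>, for a maximal cone \<open>\<sigma>\<close> of \<open>F\<close>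
  containing the cone on which \<open>x\<close> lives, and then regarded as a point of the target.
\<close>

definition toric_map ::
  "('d::finite \<Rightarrow> int ^ 'd) set \<Rightarrow> ('d, 'k::field) tpoint \<Rightarrow> ('d, 'k) tpoint" where
  "toric_map F x = (THE y. y \<in> toric_variety F \<and>
     (\<exists>w\<in>F. dual_monoid (range w) \<subseteq> dom x \<and> x |` dual_monoid (range w) \<subseteq>\<^sub>m y))"


section \<open>Fixed points, blowing-ups and codes\<close>

text \<open>
  The fixed point of the maximal cone \<open>\<sigma>\<close> sends \<open>m\<close> to \<open>1\<close> if \<open>m \<in> \<sigma>\<^sup>\<bottom>\<close> (that is, \<open>m = 0\<close>) and to \<open>0\<close>
  otherwise: it is the origin of the chart \<open>U\<^sub>\<sigma> = K\<^sup>d\<close>.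
\<close>

definition fixed_point :: "('d::finite \<Rightarrow> int ^ 'd) \<Rightarrow> ('d, 'k::field) tpoint" where
  "fixed_point w = (\<lambda>m. if m \<in> dual_monoid (range w)
     then Some (if m = 0 then 1 else 0) else None)"

definition basis_of_point ::
  "('d::finite \<Rightarrow> int ^ 'd) set \<Rightarrow> ('d, 'k::field) tpoint \<Rightarrow> ('d \<Rightarrow> int ^ 'd)" where
  "basis_of_point F x = (THE w. w \<in> F \<and> fixed_point w = x)"

definition sub_basis :: "('d::finite \<Rightarrow> int ^ 'd) \<Rightarrow> 'd \<Rightarrow> ('d \<Rightarrow> int ^ 'd)" where
  "sub_basis w a = w(a := \<Sum>i\<in>UNIV. w i)"

definition blowup_fan ::
  "('d::finite \<Rightarrow> int ^ 'd) set \<Rightarrow> ('d, 'k::field) tpoint \<Rightarrow> ('d \<Rightarrow> int ^ 'd) set" where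
  "blowup_fan F x = (F - {basis_of_point F x}) \<union> range (sub_basis (basis_of_point F x))"

text \<open>\<open>coded_point F x [a\<^sub>1, \<dots>, a\<^sub>k]\<close> is \<open>x(a\<^sub>1, \<dots>, a\<^sub>k)\<close>, for a fixed point \<open>x\<close> of the variety of \<open>F\<close>.\<close>

definition coded_point ::
  "('d::finite \<Rightarrow> int ^ 'd) set \<Rightarrow> ('d, 'k::field) tpoint \<Rightarrow> 'd list \<Rightarrow> ('d, 'k) tpoint" where
  "coded_point F x as = fixed_point (foldl sub_basis (basis_of_point F x) as)"


section \<open>Toric constellations and proximity\<close>

text \<open>
  \<open>fan v Q i\<close> is the fan of \<open>X\<^sub>i\<close>, where \<open>X\<^sub>0\<close> is the affine toric variety of the cone spanned by \<open>v\<close>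
  and \<open>X\<^sub>i\<^sub>+\<^sub>1\<close> is the blowing-up of \<open>X\<^sub>i\<close> at \<open>Q i\<close>.
\<close>

primrec fan ::
  "('d::finite \<Rightarrow> int ^ 'd) \<Rightarrow> (nat \<Rightarrow> ('d, 'k::field) tpoint) \<Rightarrow> nat \<Rightarrow> ('d \<Rightarrow> int ^ 'd) set" where
  "fan v Q 0 = {v}"
| "fan v Q (Suc i) = blowup_fan (fan v Q i) (Q i)"

text \<open>The constellation consists of the points \<open>Q 0, \<dots>, Q n\<close>; other values of \<open>Q\<close> are irrelevant.\<close>

definition toric_constellation ::
  "('d::finite \<Rightarrow> int ^ 'd) \<Rightarrow> nat \<Rightarrow> (nat \<Rightarrow> ('d, 'k::field) tpoint) \<Rightarrow> bool" where
  "toric_constellation v n Q \<longleftrightarrow>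
     (\<forall>i\<le>n. torus_fixed (fan v Q i) (Q i) \<and> toric_map (fan v Q 0) (Q i) = Q 0)"

text \<open>
  \<open>strict_transform v Q i k\<close> is \<open>E\<^sub>i\<close> in \<open>X\<^sub>i\<^sub>+\<^sub>1\<^sub>+\<^sub>k\<close>. It is the exceptional divisor \<open>B\<^sub>i\<close> for \<open>k = 0\<close>;
  passing to the next blowing-up, the centre is removed and the closure of the preimage is taken.
\<close>

primrec strict_transform ::
  "('d::finite \<Rightarrow> int ^ 'd) \<Rightarrow> (nat \<Rightarrow> ('d, 'k::field) tpoint) \<Rightarrow> nat \<Rightarrow> nat \<Rightarrow> ('d, 'k) tpoint set" where
  "strict_transform v Q i 0 =
     {x \<in> toric_variety (fan v Q (Suc i)). toric_map (fan v Q i) x = Q i}"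
| "strict_transform v Q i (Suc k) =
     zariski_closure (fan v Q (Suc (Suc (i + k))))
       {x \<in> toric_variety (fan v Q (Suc (Suc (i + k)))).
          toric_map (fan v Q (Suc (i + k))) x \<in> strict_transform v Q i k - {Q (Suc (i + k))}}"

text \<open>\<open>proximate v Q j i\<close>: the point \<open>Q j\<close> is proximate to \<open>Q i\<close>; the second conjunct is \<open>Q j \<ge> Q i\<close>.\<close>

definition proximate ::
  "('d::finite \<Rightarrow> int ^ 'd) \<Rightarrow> (nat \<Rightarrow> ('d, 'k::field) tpoint) \<Rightarrow> nat \<Rightarrow> nat \<Rightarrow> bool" where
  "proximate v Q j i \<longleftrightarrow> i < j \<and> toric_map (fan v Q i) (Q j) = Q i \<and>
     Q j \<in> strict_transform v Q i (j - Suc i)"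

end

theory Submission
  imports Defs "HOL-Computational_Algebra.Polynomial"
begin

text \<open>
  Let \<open>w\<close> be the basis of \<open>Q i\<close> and \<open>u\<close> the sum of its members, the ray added by blowing up \<open>Q i\<close>. The orbit
  of the ray \<open>u\<close> is untouched by the later blowing-ups, so it lies in every strict transform of the
  exceptional divisor, while the strict transforms stay inside the closed union of the orbits of cones
  containing \<open>u\<close>. Hence \<open>Q j\<close> lies on \<open>E\<^sub>i\<close> iff \<open>u\<close> lies in the cone of \<open>Q j\<close>. The first letter \<open>a 1\<close> puts \<open>u\<close>
  at position \<open>a 1\<close> of the basis, where it stays until \<open>a 1\<close> occurs again; at that moment \<open>u\<close> is separated
  from the new cone, and all later cones are contained in that one.
\<close>

section \<open>Lattice bases and regular fans\<close>

text \<open>Points are partial homomorphisms, so a cone is visible only through the dual monoid on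
  which a point is defined; cones of different charts are compared by biduality and interior lattice
  points. The strict transforms are never computed. They are enclosed between the orbit and the
  divisor of \<open>u\<close>, and the gap matters only at fixed points, where a curve inside the
  orbit settles membership. That \<open>K\<close> is infinite supplies a scalar other than
  \<open>0\<close> and \<open>1\<close>, which ties torus-fixed points to maximal cones, and turns a
  polynomial vanishing at all nonzero scalars into the zero polynomial. Dimension at least
  \<open>2\<close> keeps the ray \<open>u\<close> alive under later blowing-ups and provides a
  second coordinate against which it is separated.\<close>

lemma pairing_add_left: "pairing (m + m') u = pairing m u + pairing m' u"
  by (simp add: pairing_def algebra_simps sum.distrib)

lemma pairing_diff_left: "pairing (m - m') u = pairing m u - pairing m' u"
  by (simp add: pairing_def algebra_simps sum_subtractf)

lemma pairing_minus_left: "pairing (- m) u = - pairing m u"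
  by (simp add: pairing_def sum_negf)

lemma pairing_scale_left: "pairing (c *s m) u = c * pairing m u"
  by (simp add: pairing_def sum_distrib_left mult.assoc)

lemma pairing_zero_left: "pairing 0 u = 0"
  by (simp add: pairing_def)

lemma pairing_scale_right: "pairing m (c *s u) = c * pairing m u"
  by (simp add: pairing_def sum_distrib_left ac_simps)

lemma pairing_sum_right: "pairing m (\<Sum>i\<in>I. f i) = (\<Sum>i\<in>I. pairing m (f i))"
  unfolding pairing_def sum_component sum_distrib_left by (rule sum.swap)

lemmas pairing_simps = pairing_add_left pairing_diff_left pairing_minus_left pairing_scale_left
  pairing_zero_left pairing_scale_right pairing_sum_right

text \<open>The \<open>THE\<close> is specified only if \<open>w\<close> is a lattice basis.\<close>

definition dual_basis :: "('d::finite \<Rightarrow> int ^ 'd) \<Rightarrow> 'd \<Rightarrow> int ^ 'd" where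
  "dual_basis w i = (\<chi> k. (THE c. axis k 1 = (\<Sum>i\<in>UNIV. c i *s w i)) i)"

text \<open>By definition, entry \<open>k\<close> of \<open>dual_basis w i\<close> is the
  coefficient of \<open>w i\<close> in \<open>axis k 1\<close>; expand \<open>x\<close> in standard
  vectors and exchange the sums.\<close>

lemma dual_basis_expansion:
  assumes "lattice_basis w"
  shows "x = (\<Sum>i\<in>UNIV. pairing (dual_basis w i) x *s w i)"
proof -
  define c where "c k = (THE c. axis k 1 = (\<Sum>i\<in>UNIV. c i *s w i))" for k
  have c: "axis k 1 = (\<Sum>i\<in>UNIV. c k i *s w i)" for k
    unfolding c_def using assms unfolding lattice_basis_def
    by (rule theI'[OF spec[of _ "axis k 1"]])
  have "x $ l = (\<Sum>i\<in>UNIV. pairing (dual_basis w i) x *s w i) $ l" for l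
  proof -
    have "(\<Sum>i\<in>UNIV. pairing (dual_basis w i) x *s w i) $ l
        = (\<Sum>i\<in>UNIV. \<Sum>k\<in>UNIV. x $ k * (c k i * w i $ l))"
      by (simp add: pairing_def dual_basis_def c_def sum_distrib_left sum_distrib_right ac_simps)
    also have "\<dots> = (\<Sum>k\<in>UNIV. x $ k * (\<Sum>i\<in>UNIV. c k i *s w i) $ l)"
      by (subst sum.swap) (simp add: sum_distrib_left)
    also have "\<dots> = (\<Sum>k\<in>UNIV. x $ k * axis k 1 $ l)"
      by (simp only: c[symmetric])
    also have "\<dots> = x $ l"
      by (simp add: axis_def if_distrib cong: if_cong)
    finally show ?thesis by simp
  qed
  then show ?thesis by (simp add: vec_eq_iff)
qed

lemma pairing_dual_basis_sum:
  assumes "lattice_basis w"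
  shows "pairing (dual_basis w i) (\<Sum>j\<in>UNIV. c j *s w j) = c i"
proof -
  let ?x = "\<Sum>j\<in>UNIV. c j *s w j"
  have "\<exists>!c'. ?x = (\<Sum>j\<in>UNIV. c' j *s w j)"
    using assms unfolding lattice_basis_def by (rule spec)
  then obtain d where d: "\<And>c'. ?x = (\<Sum>j\<in>UNIV. c' j *s w j) \<Longrightarrow> c' = d"
    by (rule ex1E) blast
  have "(\<lambda>i. pairing (dual_basis w i) ?x) = d"
    by (rule d) (rule dual_basis_expansion[OF assms])
  also have "d = c"
    by (rule d[symmetric]) (rule refl)
  finally show ?thesis by (rule fun_cong)
qed

lemma pairing_dual_basis:
  assumes "lattice_basis w"
  shows "pairing (dual_basis w i) (w j) = (if i = j then 1 else 0)"
proof -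
  have "w j = (\<Sum>l\<in>UNIV. (if l = j then 1 else 0) *s w l)"
    by (simp add: vec_eq_iff if_distrib[of "\<lambda>c. c * _"] cong: if_cong)
  then show ?thesis
    using pairing_dual_basis_sum[OF assms, of i "\<lambda>l. if l = j then 1 else 0"] by simp
qed

lemma pairing_eq_sum:
  assumes "lattice_basis w"
  shows "pairing m x = (\<Sum>i\<in>UNIV. pairing (dual_basis w i) x * pairing m (w i))"
  by (subst dual_basis_expansion[OF assms, of x]) (simp add: pairing_simps)

lemma eq_zero_if_pairing_basis_zero:
  assumes "lattice_basis w" "\<And>i. pairing m (w i) = 0"
  shows "m = 0"
proof -
  have "pairing m x = 0" for x
    by (subst pairing_eq_sum[OF assms(1)]) (simp add: assms(2))
  moreover have "pairing m (axis k 1) = m $ k" for k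
    by (simp add: pairing_def axis_def if_distrib cong: if_cong)
  ultimately show ?thesis by (simp add: vec_eq_iff)
qed

lemma inj_lattice_basis: "lattice_basis w \<Longrightarrow> inj w"
  by (rule injI) (metis pairing_dual_basis zero_neq_one)

text \<open>The coefficient of the new vector is spread over all old ones. The change of coordinates
  only adds the \<open>a\<close>-th coordinate to the others, hence is invertible over the
  integers.\<close>

lemma sum_sub_basis:
  "(\<Sum>i\<in>UNIV. c i *s sub_basis w a i) = (\<Sum>i\<in>UNIV. (if i = a then c a else c i + c a) *s w i)"
proof -
  have "(\<Sum>i\<in>UNIV. c i *s sub_basis w a i)
      = c a *s (\<Sum>i\<in>UNIV. w i) + (\<Sum>i\<in>UNIV - {a}. c i *s w i)"
    by (subst sum.remove[of _ a]) (auto simp: sub_basis_def intro!: sum.cong)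
  also have "c a *s (\<Sum>i\<in>UNIV. w i) = (\<Sum>i\<in>UNIV. c a *s w i)"
    by (simp add: vec_eq_iff sum_distrib_left)
  also have "\<dots> = c a *s w a + (\<Sum>i\<in>UNIV - {a}. c a *s w i)"
    by (subst sum.remove[of _ a]) auto
  also have "\<dots> + (\<Sum>i\<in>UNIV - {a}. c i *s w i)
      = c a *s w a + (\<Sum>i\<in>UNIV - {a}. (c i + c a) *s w i)"
    by (simp add: vec_eq_iff algebra_simps sum.distrib)
  also have "\<dots> = (\<Sum>i\<in>UNIV. (if i = a then c a else c i + c a) *s w i)"
    by (subst (2) sum.remove[of _ a]) (auto intro!: sum.cong)
  finally show ?thesis .
qed

lemma lattice_basis_sub_basis:
  assumes "lattice_basis w"
  shows "lattice_basis (sub_basis w a)"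
  unfolding lattice_basis_def
proof
  fix x
  let ?c = "\<lambda>i. pairing (dual_basis w i) x"
  show "\<exists>!c. x = (\<Sum>i\<in>UNIV. c i *s sub_basis w a i)"
  proof (rule ex1I)
    show "x = (\<Sum>i\<in>UNIV. (if i = a then ?c a else ?c i - ?c a) *s sub_basis w a i)"
      unfolding sum_sub_basis
      by (rule trans[OF dual_basis_expansion[OF assms, of x]]) (auto intro!: sum.cong)
  next
    fix c assume c: "x = (\<Sum>i\<in>UNIV. c i *s sub_basis w a i)"
    have "?c i = (if i = a then c a else c i + c a)" for i
      unfolding c sum_sub_basis by (rule pairing_dual_basis_sum[OF assms])
    then show "c = (\<lambda>i. if i = a then ?c a else ?c i - ?c a)"
      by auto
  qed
qed

lemma pairing_dual_sub_basis:
  assumes "lattice_basis w"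
  shows "pairing (dual_basis (sub_basis w a) i) x =
    (if i = a then pairing (dual_basis w a) x
     else pairing (dual_basis w i) x - pairing (dual_basis w a) x)"
proof -
  let ?c = "\<lambda>i. pairing (dual_basis (sub_basis w a) i) x"
  have "x = (\<Sum>i\<in>UNIV. (if i = a then ?c a else ?c i + ?c a) *s w i)"
    using dual_basis_expansion[OF lattice_basis_sub_basis[OF assms], of x a]
    by (simp only: sum_sub_basis)
  from arg_cong[OF this, of "pairing (dual_basis w _)"]
  have "pairing (dual_basis w i) x = (if i = a then ?c a else ?c i + ?c a)" for i
    unfolding pairing_dual_basis_sum[OF assms] .
  then show ?thesis by simp
qed

section \<open>Cones, their faces and their dual monoids\<close>

definition in_cone :: "('d::finite \<Rightarrow> int ^ 'd) \<Rightarrow> int ^ 'd \<Rightarrow> bool" where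
  "in_cone w x \<longleftrightarrow> (\<forall>i. 0 \<le> pairing (dual_basis w i) x)"

text \<open>For \<open>x\<close> in the cone of \<open>w\<close>, these are the generators of the
  smallest face containing \<open>x\<close>.\<close>

definition support :: "('d::finite \<Rightarrow> int ^ 'd) \<Rightarrow> int ^ 'd \<Rightarrow> (int ^ 'd) set" where
  "support w x = w ` {i. pairing (dual_basis w i) x \<noteq> 0}"

lemma dual_monoid_add: "m \<in> dual_monoid G \<Longrightarrow> m' \<in> dual_monoid G \<Longrightarrow> m + m' \<in> dual_monoid G"
  by (simp add: dual_monoid_def pairing_simps)

lemma zero_in_dual_monoid: "0 \<in> dual_monoid G"
  by (simp add: dual_monoid_def pairing_simps)

lemma dual_monoid_scale: "r \<in> dual_monoid G \<Longrightarrow> int N *s r \<in> dual_monoid G"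
  by (simp add: dual_monoid_def pairing_simps)

lemma dual_monoid_antimono: "G \<subseteq> H \<Longrightarrow> dual_monoid H \<subseteq> dual_monoid G"
  by (auto simp: dual_monoid_def)

lemma dual_basis_in_dual_monoid: "lattice_basis w \<Longrightarrow> G \<subseteq> range w \<Longrightarrow> dual_basis w i \<in> dual_monoid G"
  by (auto simp: dual_monoid_def pairing_dual_basis)

text \<open>The test characters are \<open>dual_basis w i\<close>, which forces nonnegative
  coordinates, and \<open>- dual_basis w i\<close> for \<open>w i\<close> outside \<open>G\<close>,
  which forces those coordinates to vanish.\<close>

lemma bidual:
  assumes "lattice_basis w" "G \<subseteq> range w"
  shows "(\<forall>m\<in>dual_monoid G. 0 \<le> pairing m x) \<longleftrightarrow> in_cone w x \<and> support w x \<subseteq> G"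
proof
  assume *: "\<forall>m\<in>dual_monoid G. 0 \<le> pairing m x"
  have "in_cone w x"
    using * dual_basis_in_dual_monoid[OF assms] by (simp add: in_cone_def)
  moreover have "pairing (dual_basis w i) x = 0" if "w i \<notin> G" for i
  proof -
    have "- dual_basis w i \<in> dual_monoid G"
      using assms that by (auto simp: dual_monoid_def pairing_simps pairing_dual_basis)
    then have "0 \<le> - pairing (dual_basis w i) x"
      using * by (metis pairing_minus_left)
    then show ?thesis
      using \<open>in_cone w x\<close> by (simp add: in_cone_def eq_iff)
  qed
  ultimately show "in_cone w x \<and> support w x \<subseteq> G"
    by (auto simp: support_def)
next
  assume *: "in_cone w x \<and> support w x \<subseteq> G"
  show "\<forall>m\<in>dual_monoid G. 0 \<le> pairing m x"
  proof
    fix m assume m: "m \<in> dual_monoid G"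
    show "0 \<le> pairing m x"
      unfolding pairing_eq_sum[OF assms(1), of m x]
    proof (rule sum_nonneg)
      fix i
      show "0 \<le> pairing (dual_basis w i) x * pairing m (w i)"
      proof (cases "pairing (dual_basis w i) x = 0")
        case False
        then have "w i \<in> G" using * by (auto simp: support_def)
        then show ?thesis using * m by (simp add: in_cone_def dual_monoid_def)
      qed simp
    qed
  qed
qed

lemma support_subset: "support w x \<subseteq> range w"
  by (auto simp: support_def)

lemma in_cone_iff:
  "lattice_basis w \<Longrightarrow> in_cone w x \<longleftrightarrow> (\<forall>m\<in>dual_monoid (range w). 0 \<le> pairing m x)"
  using bidual[of w "range w" x] support_subset[of w x] by auto

text \<open>The witness is the sum of the members of \<open>G\<close>. Such a relative interior
  point allows a face to be recognised inside other maximal cones.\<close>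

lemma ex_support_eq:
  assumes "lattice_basis w" "G \<subseteq> range w"
  shows "\<exists>z. in_cone w z \<and> support w z = G"
proof -
  define z where "z = (\<Sum>i\<in>UNIV. (if w i \<in> G then 1 else 0) *s w i)"
  have "pairing (dual_basis w i) z = (if w i \<in> G then 1 else 0)" for i
    unfolding z_def by (rule pairing_dual_basis_sum[OF assms(1)])
  then show ?thesis
    using assms by (intro exI[of _ z]) (auto simp: in_cone_def support_def)
qed

lemma in_cone_basis: "lattice_basis w \<Longrightarrow> in_cone w (w i)"
  by (simp add: in_cone_def pairing_dual_basis)

lemma pairing_dual_basis_Sum: "lattice_basis w \<Longrightarrow> pairing (dual_basis w i) (\<Sum>j\<in>UNIV. w j) = 1"
  by (simp add: pairing_simps pairing_dual_basis)

lemma in_cone_Sum: "lattice_basis w \<Longrightarrow> in_cone w (\<Sum>i\<in>UNIV. w i)"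
  by (simp add: in_cone_def pairing_dual_basis_Sum)

lemma support_Sum: "lattice_basis w \<Longrightarrow> support w (\<Sum>i\<in>UNIV. w i) = range w"
  by (simp add: support_def pairing_dual_basis_Sum)

lemma dual_monoid_subset_sub_basis:
  "dual_monoid (range w) \<subseteq> dual_monoid (range (sub_basis w a))"
  by (auto simp: dual_monoid_def sub_basis_def pairing_simps intro: sum_nonneg)

lemma card_range_basis: "lattice_basis (w :: 'd::finite \<Rightarrow> int ^ 'd) \<Longrightarrow> card (range w) = CARD('d)"
  by (simp add: card_image inj_lattice_basis)

lemma ex_other_index:
  assumes "CARD('d::finite) \<ge> 2"
  shows "\<exists>b::'d. b \<noteq> a"
proof (rule ccontr)
  assume "\<not> ?thesis"
  then have "(UNIV :: 'd set) = {a}" by auto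
  then show False using assms by (metis card.empty card.insert empty_iff finite.emptyI not_less_eq_eq numeral_2_eq_2 le_refl)
qed

text \<open>
  The last condition says that cones of \<open>F\<close> meet along common faces: a lattice point of the support of
  the fan lies in the relative interior of only one cone.
\<close>

definition regular_fan :: "('d::finite \<Rightarrow> int ^ 'd) set \<Rightarrow> bool" where
  "regular_fan F \<longleftrightarrow> (\<forall>w\<in>F. lattice_basis w) \<and> inj_on range F \<and>
     (\<forall>w\<in>F. \<forall>w'\<in>F. \<forall>x. in_cone w x \<longrightarrow> in_cone w' x \<longrightarrow> support w x = support w' x)"

lemma regular_fanD:
  assumes "regular_fan F"
  shows "w \<in> F \<Longrightarrow> lattice_basis w"
    and "w \<in> F \<Longrightarrow> w' \<in> F \<Longrightarrow> range w = range w' \<Longrightarrow> w = w'"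
    and "w \<in> F \<Longrightarrow> w' \<in> F \<Longrightarrow> in_cone w x \<Longrightarrow> in_cone w' x \<Longrightarrow> support w x = support w' x"
  using assms unfolding regular_fan_def inj_on_def by blast+

text \<open>The two cones may come from different bases. A relative interior point \<open>z\<close>
  of the cone of \<open>G\<close> lies in that of \<open>G'\<close> by biduality, and the fan
  condition gives it the same support for both bases.\<close>

lemma face_subset:
  assumes "regular_fan F" "G \<in> cones F" "G' \<in> cones F" "dual_monoid G' \<subseteq> dual_monoid G"
  shows "G \<subseteq> G'"
proof -
  obtain w w' where w: "w \<in> F" "G \<subseteq> range w" "w' \<in> F" "G' \<subseteq> range w'"
    using assms by (auto simp: cones_def)
  note lb = regular_fanD(1)[OF assms(1) w(1)] regular_fanD(1)[OF assms(1) w(3)]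
  obtain z where z: "in_cone w z" "support w z = G"
    using ex_support_eq[OF lb(1) w(2)] by blast
  then have "\<forall>m\<in>dual_monoid G'. 0 \<le> pairing m z"
    using bidual[OF lb(1) w(2), of z] assms(4) by blast
  then have "in_cone w' z" "support w' z \<subseteq> G'"
    using bidual[OF lb(2) w(4)] by auto
  then show ?thesis
    using regular_fanD(3)[OF assms(1) w(1) w(3) z(1)] z(2) by auto
qed

lemma range_in_cones: "w \<in> F \<Longrightarrow> range w \<in> cones F"
  by (auto simp: cones_def)

text \<open>Every new coordinate other than the \<open>a\<close>-th is the old one minus the
  \<open>a\<close>-th, so the subcone is the part of the cone of \<open>w\<close> where the
  \<open>a\<close>-th coordinate is minimal.\<close>

lemma in_cone_sub_basis:
  assumes "lattice_basis w" "in_cone (sub_basis w a) x"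
  shows "in_cone w x" and "\<And>i. pairing (dual_basis w a) x \<le> pairing (dual_basis w i) x"
proof -
  have *: "0 \<le> (if i = a then pairing (dual_basis w a) x
     else pairing (dual_basis w i) x - pairing (dual_basis w a) x)" for i
    using assms(2) unfolding in_cone_def pairing_dual_sub_basis[OF assms(1)] by blast
  show "pairing (dual_basis w a) x \<le> pairing (dual_basis w i) x" for i
    using *[of i] by (auto split: if_splits)
  then show "in_cone w x"
    using *[of a] by (auto simp: in_cone_def intro: order_trans)
qed

lemma support_sub_basis:
  assumes "lattice_basis w"
  shows "support (sub_basis w a) x =
    (if pairing (dual_basis w a) x = 0 then {} else {\<Sum>i\<in>UNIV. w i}) \<union>
    w ` {i. pairing (dual_basis w i) x \<noteq> pairing (dual_basis w a) x}"
  unfolding support_def pairing_dual_sub_basis[OF assms]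
  by (auto simp: sub_basis_def image_iff split: if_splits)

lemma range_sub_basis:
  "range (sub_basis w a) = insert (\<Sum>i\<in>UNIV. w i) (w ` (- {a}))"
  by (auto simp: sub_basis_def image_iff)

lemma Sum_neq_basis:
  assumes "CARD('d) \<ge> 2" "lattice_basis (w :: 'd::finite \<Rightarrow> int ^ 'd)"
  shows "(\<Sum>i\<in>UNIV. w i) \<noteq> w a"
proof
  assume "(\<Sum>i\<in>UNIV. w i) = w a"
  moreover obtain b where "b \<noteq> a" using ex_other_index[OF assms(1)] by blast
  ultimately show False
    using pairing_dual_basis_Sum[OF assms(2), of b] pairing_dual_basis[OF assms(2), of b a] by simp
qed

lemma regular_fan_blowup:
  fixes F :: "('d::finite \<Rightarrow> int ^ 'd) set"
  assumes d: "CARD('d) \<ge> 2" and F: "regular_fan F" and w: "w \<in> F"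
  shows "regular_fan (F - {w} \<union> range (sub_basis w))"
proof -
  let ?s = "\<Sum>i\<in>UNIV. w i" and ?F' = "F - {w} \<union> range (sub_basis w)"
  note lb = regular_fanD(1)[OF F] and inj = regular_fanD(2)[OF F] and supp = regular_fanD(3)[OF F]
  note lbw = lb[OF w]
  \<comment> \<open>The sum \<open>?s\<close> is interior to the cone of \<open>w\<close>; as a
    generator of an old cone it would have a single supporting generator instead of all those of
    \<open>w\<close>.\<close>
  have range_new_old: False if "w' \<in> F - {w}" "range (sub_basis w a) = range w'" for w' a
  proof -
    have "?s \<in> range w'"
      using that range_sub_basis[of w a] by auto
    then obtain p where p: "?s = w' p" by auto
    have "range w = support w' ?s"
      using supp[of w w' ?s] support_Sum[OF lbw] in_cone_Sum[OF lbw] w that p in_cone_basis[OF lb, of w' p]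
      by simp
    also have "\<dots> = {w' p}"
      using lb[of w'] that p by (auto simp: support_def pairing_dual_basis)
    finally show False using card_range_basis[OF lbw] d by simp
  qed
  \<comment> \<open>\<open>w a\<close> is a generator of every subcone except the one at position
    \<open>a\<close>.\<close>
  have range_new_new: "a = b" if "range (sub_basis w a) = range (sub_basis w b)" for a b
  proof (rule ccontr)
    assume "a \<noteq> b"
    then have "w a \<in> range (sub_basis w b)"
      by (auto simp: range_sub_basis)
    then have "w a \<in> range (sub_basis w a)"
      using that by simp
    then show False
      using Sum_neq_basis[OF d lbw, of a] inj_lattice_basis[OF lbw]
      by (auto simp: range_sub_basis inj_def)
  qed
  have supp_new_new: "support (sub_basis w a) x = support (sub_basis w b) x"
    if "in_cone (sub_basis w a) x" "in_cone (sub_basis w b) x" for a b x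
  proof -
    have "pairing (dual_basis w a) x = pairing (dual_basis w b) x"
      using in_cone_sub_basis(2)[OF lbw] that by (intro antisym) blast+
    then show ?thesis by (simp add: support_sub_basis[OF lbw])
  qed
  have supp_new_old: "support (sub_basis w a) x = support w' x"
    if x: "in_cone (sub_basis w a) x" "in_cone w' x" and w': "w' \<in> F - {w}" for a x w'
  proof -
    note c = in_cone_sub_basis[OF lbw x(1)]
    have eq: "support w x = support w' x"
      using supp w w' c(1) x(2) by blast
    \<comment> \<open>A positive minimal coordinate would put \<open>x\<close> in the interior of
      the cone of \<open>w\<close>, and the old cone would then have the same generators as
      \<open>w\<close>.\<close>
    have "pairing (dual_basis w a) x = 0"
    proof (rule ccontr)
      assume "pairing (dual_basis w a) x \<noteq> 0"
      then have "pairing (dual_basis w a) x > 0"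
        using c(1) by (simp add: in_cone_def order_le_neq_trans)
      then have "pairing (dual_basis w i) x \<noteq> 0" for i
        using c(2)[of i] by linarith
      then have "range w = support w x" by (simp add: support_def)
      then have "range w \<subseteq> range w'" using eq support_subset by metis
      moreover have "card (range w) = card (range w')"
        using card_range_basis[OF lbw] card_range_basis[OF lb, of w'] w' by simp
      ultimately have "range w = range w'"
        by (intro card_subset_eq) auto
      then show False using inj w w' by blast
    qed
    then have "support (sub_basis w a) x = support w x"
      unfolding support_sub_basis[OF lbw] by (simp add: support_def)
    then show ?thesis using eq by simp
  qed
  have "inj_on range ?F'"
    unfolding inj_on_def using range_new_old range_new_new inj by (auto; metis)
  moreover have "support w1 x = support w2 x"
    if "w1 \<in> ?F'" "w2 \<in> ?F'" "in_cone w1 x" "in_cone w2 x" for w1 w2 x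
  proof -
    consider (old_old) "w1 \<in> F - {w}" "w2 \<in> F - {w}"
      | (new_old) a where "w1 = sub_basis w a" "w2 \<in> F - {w}"
      | (old_new) b where "w1 \<in> F - {w}" "w2 = sub_basis w b"
      | (new_new) a b where "w1 = sub_basis w a" "w2 = sub_basis w b"
      using \<open>w1 \<in> ?F'\<close> \<open>w2 \<in> ?F'\<close> by auto
    then show ?thesis
    proof cases
      case old_old
      then show ?thesis using supp that(3,4) by blast
    next
      case new_old
      then show ?thesis using supp_new_old that(3,4) by blast
    next
      case old_new
      then show ?thesis using supp_new_old[symmetric] that(3,4) by blast
    next
      case new_new
      then show ?thesis using supp_new_new that(3,4) by blast
    qed
  qed
  ultimately show ?thesis
    unfolding regular_fan_def using lb lattice_basis_sub_basis[OF lbw] by blast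
qed

section \<open>Torus orbits\<close>

lemma monoid_homsD:
  assumes "x \<in> monoid_homs S"
  shows "dom x = S" "x 0 = Some 1"
    "m \<in> S \<Longrightarrow> m' \<in> S \<Longrightarrow> x (m + m') = Some (the (x m) * the (x m'))"
  using assms by (auto simp: monoid_homs_def)

lemma hom_unit:
  assumes x: "x \<in> monoid_homs (dual_monoid G)" and m: "\<forall>g\<in>G. pairing m g = 0"
  shows "x m \<noteq> Some 0"
proof
  assume "x m = Some 0"
  moreover have "m \<in> dual_monoid G" "- m \<in> dual_monoid G"
    using m by (auto simp: dual_monoid_def pairing_simps)
  ultimately have "x (m + - m) = Some 0"
    using monoid_homsD(3)[OF x, of m "- m"] by simp
  then show False
    using monoid_homsD(2)[OF x] by simp
qed

lemma hom_scale:
  assumes x: "x \<in> monoid_homs (dual_monoid G)" and r: "r \<in> dual_monoid G"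
  shows "x (int N *s r) = Some (the (x r) ^ N)"
proof (induction N)
  case 0
  then show ?case using monoid_homsD(2)[OF x] by simp
next
  case (Suc N)
  have "int (Suc N) *s r = r + int N *s r"
    by (simp add: vec_eq_iff algebra_simps)
  then show ?case
    using monoid_homsD(3)[OF x r dual_monoid_scale[OF r, of N]] Suc by simp
qed

lemma dual_monoid_shift:
  assumes "finite G" and r: "r \<in> dual_monoid G"
    and m: "m \<in> dual_monoid {g \<in> G. pairing r g = 0}"
  shows "\<exists>k. m + int k *s r \<in> dual_monoid G"
proof
  \<comment> \<open>This sum dominates each absolute value, and \<open>pairing r g\<close> is at
    least \<open>1\<close> wherever it is nonzero.\<close>
  let ?k = "nat (\<Sum>g\<in>G. \<bar>pairing m g\<bar>)"
  have "0 \<le> pairing m g + int ?k * pairing r g" if g: "g \<in> G" for g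
  proof (cases "pairing r g = 0")
    case True
    then show ?thesis using m g by (simp add: dual_monoid_def)
  next
    case False
    then have 1: "1 \<le> pairing r g"
      using r g by (force simp: dual_monoid_def)
    have k: "int ?k = (\<Sum>g\<in>G. \<bar>pairing m g\<bar>)"
      by (simp add: sum_nonneg)
    have "\<bar>pairing m g\<bar> \<le> int ?k"
      unfolding k using assms(1) g by (intro member_le_sum) auto
    moreover have "int ?k * 1 \<le> int ?k * pairing r g"
      using 1 by (intro mult_left_mono) auto
    ultimately show ?thesis by linarith
  qed
  then show "m + int ?k *s r \<in> dual_monoid G"
    by (simp add: dual_monoid_def pairing_simps)
qed

text \<open>A point of \<open>U\<^sub>\<tau>\<close>, where \<open>\<tau>\<close> is spanned by \<open>G\<close>, that lies on no \<open>U\<close> of a proper face of \<open>\<tau>\<close>.\<close>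

definition orbit :: "(int ^ 'd::finite) set \<Rightarrow> ('d, 'k::field) tpoint set" where
  "orbit G = {x \<in> monoid_homs (dual_monoid G).
     \<forall>m\<in>dual_monoid G. x m \<noteq> Some 0 \<longrightarrow> (\<forall>g\<in>G. pairing m g = 0)}"

lemma orbit_hom: "x \<in> orbit G \<Longrightarrow> x \<in> monoid_homs (dual_monoid G)"
  by (simp add: orbit_def)

lemma dom_orbit: "x \<in> orbit G \<Longrightarrow> dom x = dual_monoid G"
  by (simp add: orbit_hom monoid_homsD(1))

lemma orbit_zero_iff:
  "x \<in> orbit G \<Longrightarrow> m \<in> dual_monoid G \<Longrightarrow> x m = Some 0 \<longleftrightarrow> (\<exists>g\<in>G. pairing m g \<noteq> 0)"
  using hom_unit[of x G m] by (auto simp: orbit_def)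

lemma finite_cone: "G \<in> cones F \<Longrightarrow> finite (G :: (int ^ 'd::finite) set)"
  by (auto simp: cones_def intro: finite_subset)

text \<open>If \<open>w p\<close> were in \<open>G\<close> but not in \<open>G'\<close>, the
  character \<open>dual_basis w p\<close> would vanish at \<open>x\<close> and yet be invertible at
  the extension \<open>y\<close>.\<close>

lemma orbit_maximal:
  assumes F: "regular_fan F" and G: "G \<in> cones F" "G' \<in> cones F"
    and x: "x \<in> orbit G" and y: "y \<in> monoid_homs (dual_monoid G')" and le: "x \<subseteq>\<^sub>m y"
  shows "y = x"
proof -
  have sub: "dual_monoid G \<subseteq> dual_monoid G'"
    using map_le_implies_dom_le[OF le] dom_orbit[OF x] monoid_homsD(1)[OF y] by simp
  then have G'G: "G' \<subseteq> G"
    using face_subset F G by blast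
  have "G \<subseteq> G'"
  proof (rule ccontr)
    assume "\<not> G \<subseteq> G'"
    moreover obtain w where w: "w \<in> F" "G \<subseteq> range w" using G by (auto simp: cones_def)
    ultimately obtain p where p: "w p \<in> G" "w p \<notin> G'" by blast
    note lb = regular_fanD(1)[OF F w(1)]
    let ?e = "dual_basis w p"
    have e: "?e \<in> dual_monoid G"
      using dual_basis_in_dual_monoid[OF lb w(2)] .
    have "x ?e = Some 0"
      unfolding orbit_zero_iff[OF x e] using p(1) by (intro bexI[of _ "w p"]) (simp_all add: pairing_dual_basis[OF lb])
    then have "y ?e = Some 0"
      using le e dom_orbit[OF x] by (simp add: map_le_def)
    moreover have "\<forall>g\<in>G'. pairing ?e g = 0"
    proof
      fix g assume "g \<in> G'"
      then obtain q where "g = w q" "q \<noteq> p" using G'G w(2) p(2) by blast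
      then show "pairing ?e g = 0" by (simp add: pairing_dual_basis[OF lb])
    qed
    ultimately show False using hom_unit[OF y] by blast
  qed
  then have "dom y = dom x"
    using G'G dom_orbit[OF x] monoid_homsD(1)[OF y] by auto
  then show ?thesis
    using le by (metis map_le_antisym map_le_def)
qed

text \<open>
  Localisation at the character \<open>r\<close>: the extension sends \<open>m\<close> to \<open>x (m + k r) / x(r)\<^sup>k\<close> for large \<open>k\<close>.
\<close>

lemma hom_extend:
  assumes G: "finite G" and x: "x \<in> monoid_homs (dual_monoid G)"
    and r: "r \<in> dual_monoid G" "x r \<noteq> Some 0"
  shows "\<exists>y\<in>monoid_homs (dual_monoid {g \<in> G. pairing r g = 0}). x \<subseteq>\<^sub>m y"
proof -
  let ?H = "{g \<in> G. pairing r g = 0}"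
  define c where "c = the (x r)"
  have c0: "c \<noteq> 0"
    using r monoid_homsD(1)[OF x] by (force simp: c_def)
  \<comment> \<open>An arbitrary sufficient exponent; \<open>y_eq\<close> shows that the quotient
    does not depend on it.\<close>
  define N where "N m = (SOME k. m + int k *s r \<in> dual_monoid G)" for m
  have N: "m + int (N m) *s r \<in> dual_monoid G" if "m \<in> dual_monoid ?H" for m
    unfolding N_def using dual_monoid_shift[OF G r(1) that] by (rule someI_ex)
  have xsh: "the (x (n + int l *s r)) = the (x n) * c ^ l" if "n \<in> dual_monoid G" for n l
    using monoid_homsD(3)[OF x that dual_monoid_scale[OF r(1), of l]] hom_scale[OF x r(1), of l]
    by (simp add: c_def)
  define y where "y m = (if m \<in> dual_monoid ?H
    then Some (the (x (m + int (N m) *s r)) / c ^ N m) else None)" for m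
  have y_eq: "y m = Some (the (x (m + int k *s r)) / c ^ k)"
    if m: "m \<in> dual_monoid ?H" and k: "m + int k *s r \<in> dual_monoid G" for m k
  proof -
    have "(m + int (N m) *s r) + int k *s r = (m + int k *s r) + int (N m) *s r"
      by (simp add: ac_simps)
    then have "the (x (m + int (N m) *s r)) * c ^ k = the (x (m + int k *s r)) * c ^ N m"
      using xsh[OF N[OF m], of k] xsh[OF k, of "N m"] by metis
    then show ?thesis
      using m c0 by (simp add: y_def field_simps)
  qed
  have HG: "dual_monoid G \<subseteq> dual_monoid ?H"
    by (rule dual_monoid_antimono) auto
  have y_x: "y m = x m" if "m \<in> dual_monoid G" for m
    using y_eq[of m 0] that HG monoid_homsD(1)[OF x] by force
  have "y (m + m') = Some (the (y m) * the (y m'))"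
    if m: "m \<in> dual_monoid ?H" and m': "m' \<in> dual_monoid ?H" for m m'
  proof -
    let ?n = "m + int (N m) *s r" and ?n' = "m' + int (N m') *s r"
    have eq: "(m + m') + int (N m + N m') *s r = ?n + ?n'"
      by (simp add: vec_eq_iff algebra_simps)
    have "y (m + m') = Some (the (x (?n + ?n')) / c ^ (N m + N m'))"
      using y_eq[of "m + m'" "N m + N m'"] dual_monoid_add[OF m m'] dual_monoid_add[OF N[OF m] N[OF m']]
      unfolding eq by blast
    also have "the (x (?n + ?n')) = the (x ?n) * the (x ?n')"
      using monoid_homsD(3)[OF x N[OF m] N[OF m']] by simp
    finally show ?thesis
      using m m' by (simp add: y_def power_add)
  qed
  moreover have "dom y = dual_monoid ?H"
    by (auto simp: y_def split: if_splits)
  moreover have "y 0 = Some 1"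
    using y_x[OF zero_in_dual_monoid] monoid_homsD(2)[OF x] by simp
  ultimately have "y \<in> monoid_homs (dual_monoid ?H)"
    by (simp add: monoid_homs_def)
  moreover have "x \<subseteq>\<^sub>m y"
    using y_x monoid_homsD(1)[OF x] by (simp add: map_le_def)
  ultimately show ?thesis by blast
qed

lemma cones_subset: "G \<in> cones F \<Longrightarrow> H \<subseteq> G \<Longrightarrow> H \<in> cones F"
  by (auto simp: cones_def)

text \<open>The orbit decomposition. A character that is nonzero at \<open>x\<close> but not
  orthogonal to \<open>G\<close> could be inverted, extending \<open>x\<close> to a proper face
  against maximality.\<close>

lemma toric_variety_eq:
  assumes F: "regular_fan F"
  shows "toric_variety F = (\<Union>G\<in>cones F. orbit G)"
proof
  show "(\<Union>G\<in>cones F. orbit G) \<subseteq> toric_variety F"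
  proof
    fix x assume "x \<in> (\<Union>G\<in>cones F. orbit G)"
    then obtain G where G: "G \<in> cones F" "x \<in> orbit G" by blast
    then show "x \<in> toric_variety F"
      using orbit_hom orbit_maximal[OF F] unfolding toric_variety_def local_points_def by blast
  qed
  show "toric_variety F \<subseteq> (\<Union>G\<in>cones F. orbit G)"
  proof
    fix x assume x: "x \<in> toric_variety F"
    then obtain G where G: "G \<in> cones F" "x \<in> monoid_homs (dual_monoid G)"
      by (auto simp: toric_variety_def local_points_def)
    have "pairing r g = 0" if r: "r \<in> dual_monoid G" "x r \<noteq> Some 0" and g: "g \<in> G" for r g
    proof -
      let ?H = "{g \<in> G. pairing r g = 0}"
      obtain y where y: "y \<in> monoid_homs (dual_monoid ?H)" "x \<subseteq>\<^sub>m y"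
        using hom_extend[OF finite_cone[OF G(1)] G(2) r] by blast
      moreover have "y \<in> local_points F"
        using y(1) cones_subset[OF G(1), of ?H] by (auto simp: local_points_def)
      ultimately have "y = x"
        using x by (simp add: toric_variety_def)
      then have "dual_monoid ?H = dual_monoid G"
        using monoid_homsD(1) y(1) G(2) by metis
      moreover have "- r \<in> dual_monoid ?H"
        by (simp add: dual_monoid_def pairing_simps)
      ultimately have "- r \<in> dual_monoid G" by simp
      then have "pairing r g \<le> 0"
        using g by (auto simp: dual_monoid_def pairing_simps)
      then show ?thesis
        using r(1) g by (simp add: dual_monoid_def eq_iff)
    qed
    then have "x \<in> orbit G"
      using G(2) by (simp add: orbit_def)
    then show "x \<in> (\<Union>G\<in>cones F. orbit G)"
      using G(1) by blast
  qed
qed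

text \<open>The zeros among the dual basis determine the generators of the cone. Every other
  character is moved into the monoid of the chart by a multiple of a character invertible on the
  orbit.\<close>

lemma orbit_eqI:
  assumes lb: "lattice_basis w" and GH: "G \<subseteq> range w" "H \<subseteq> range w"
    and x: "x \<in> orbit G" and y: "y \<in> orbit H"
    and eq: "\<And>m. m \<in> dual_monoid (range w) \<Longrightarrow> x m = y m"
  shows "x = y"
proof -
  have zero: "z (dual_basis w p) = Some 0 \<longleftrightarrow> w p \<in> K" if K: "K \<subseteq> range w" "z \<in> orbit K" for z K p
    unfolding orbit_zero_iff[OF K(2) dual_basis_in_dual_monoid[OF lb K(1)]]
  proof
    assume "\<exists>g\<in>K. pairing (dual_basis w p) g \<noteq> 0"
    then obtain q where "w q \<in> K" "pairing (dual_basis w p) (w q) \<noteq> 0"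
      using K(1) by blast
    then show "w p \<in> K"
      by (auto simp: pairing_dual_basis[OF lb] split: if_splits)
  qed (auto intro!: bexI[of _ "w p"] simp: pairing_dual_basis[OF lb])
  have "w p \<in> G \<longleftrightarrow> w p \<in> H" for p
    using zero[OF GH(1) x] zero[OF GH(2) y] eq[OF dual_basis_in_dual_monoid[OF lb order_refl]] by simp
  then have "G = H" using GH by blast
  \<comment> \<open>Among the generators of \<open>w\<close>, this character is zero exactly on
    those in \<open>G\<close>, so localising at it passes from the cone of \<open>w\<close> to its
    face \<open>G\<close>.\<close>
  define r where "r = (\<Sum>i\<in>{i. w i \<notin> G}. dual_basis w i)"
  have "pairing r u = (\<Sum>i\<in>{i. w i \<notin> G}. pairing (dual_basis w i) u)" for u
    unfolding r_def by (induction rule: infinite_finite_induct) (auto simp: pairing_simps)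
  then have r: "pairing r (w j) = (if w j \<in> G then 0 else 1)" for j
    by (simp add: pairing_dual_basis[OF lb])
  have rw: "r \<in> dual_monoid (range w)"
    by (auto simp: dual_monoid_def r)
  have rG: "r \<in> dual_monoid G" "\<forall>g\<in>G. pairing r g = 0"
    using GH(1) r by (auto simp: dual_monoid_def)
  have G_eq: "{g \<in> range w. pairing r g = 0} = G"
    using GH(1) r by (auto split: if_splits)
  have "x m = y m" if m: "m \<in> dual_monoid G" for m
  proof -
    obtain k where k: "m + int k *s r \<in> dual_monoid (range w)"
      using dual_monoid_shift[OF _ rw, of m] m unfolding G_eq by auto
    have *: "z (m + int k *s r) = Some (the (z m) * the (z r) ^ k)" "the (z r) \<noteq> 0" "z m = Some (the (z m))"
      if "z \<in> orbit G" for z :: "('a, 'b) tpoint"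
    proof -
      note z = orbit_hom[OF that]
      show "z (m + int k *s r) = Some (the (z m) * the (z r) ^ k)"
        using monoid_homsD(3)[OF z m dual_monoid_scale[OF rG(1), of k]] hom_scale[OF z rG(1)] by simp
      show "the (z r) \<noteq> 0"
        using hom_unit[OF z rG(2)] rG(1) monoid_homsD(1)[OF z] by force
      show "z m = Some (the (z m))"
        using m monoid_homsD(1)[OF z] by force
    qed
    have y': "y \<in> orbit G" using y \<open>G = H\<close> by simp
    have "the (x m) * the (x r) ^ k = the (y m) * the (y r) ^ k"
      using eq[OF k] *(1)[OF x] *(1)[OF y'] by simp
    then show ?thesis
      using eq[OF rw] *(2,3)[OF x] *(3)[OF y'] by simp
  qed
  moreover have "x m = None" "y m = None" if "m \<notin> dual_monoid G" for m
    using that dom_orbit[OF x] dom_orbit[OF y] \<open>G = H\<close> by auto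
  ultimately show ?thesis by (metis ext)
qed

section \<open>Toric morphisms\<close>

text \<open>
  The point \<open>z\<close> of the cone of \<open>x\<close> determines the smallest cone of \<open>F\<close> containing the cone of \<open>x\<close>.
\<close>

lemma toric_map_eqI:
  assumes F: "regular_fan F" and w: "w \<in> F" "in_cone w z"
    and x: "dom x = dual_monoid G" and z: "\<And>m. m \<in> dual_monoid G \<Longrightarrow> 0 \<le> pairing m z"
    and y: "y \<in> orbit (support w z)" "y \<subseteq>\<^sub>m x"
  shows "toric_map F x = y"
  unfolding toric_map_def
proof (rule the_equality)
  note lb = regular_fanD(1)[OF F]
  have supp: "support w z \<in> cones F"
    using w(1) support_subset[of w z] by (auto simp: cones_def)
  have le: "dual_monoid (range w) \<subseteq> dom y"
    unfolding dom_orbit[OF y(1)] by (rule dual_monoid_antimono[OF support_subset])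
  show "y \<in> toric_variety F \<and>
    (\<exists>w\<in>F. dual_monoid (range w) \<subseteq> dom x \<and> x |` dual_monoid (range w) \<subseteq>\<^sub>m y)"
  proof
    show "y \<in> toric_variety F"
      using y(1) supp toric_variety_eq[OF F] by blast
    have "dual_monoid (range w) \<subseteq> dom x"
      using le map_le_implies_dom_le[OF y(2)] by blast
    moreover have "x |` dual_monoid (range w) \<subseteq>\<^sub>m y"
      using le y(2) by (force simp: map_le_def)
    ultimately show "\<exists>w\<in>F. dual_monoid (range w) \<subseteq> dom x \<and> x |` dual_monoid (range w) \<subseteq>\<^sub>m y"
      using w(1) by blast
  qed
  fix y' assume y': "y' \<in> toric_variety F \<and>
    (\<exists>w\<in>F. dual_monoid (range w) \<subseteq> dom x \<and> x |` dual_monoid (range w) \<subseteq>\<^sub>m y')"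
  then obtain w' where w': "w' \<in> F" "dual_monoid (range w') \<subseteq> dom x"
    "x |` dual_monoid (range w') \<subseteq>\<^sub>m y'" by blast
  obtain H where H: "H \<in> cones F" "y' \<in> orbit H"
    using y' toric_variety_eq[OF F] by blast
  \<comment> \<open>Every competing chart also contains \<open>z\<close>, so its cone has the
    smallest cone \<open>support w z\<close> as a face; this makes the choice of \<open>w'\<close>
    immaterial.\<close>
  have "in_cone w' z"
    unfolding in_cone_iff[OF lb[OF w'(1)]] using w'(2) x z by blast
  then have sub: "support w z \<subseteq> range w'"
    using regular_fanD(3)[OF F w(1) w'(1) w(2)] support_subset by metis
  have x_y': "x m = y' m" if "m \<in> dual_monoid (range w')" for m
    using w'(2,3) that by (auto simp: map_le_def)
  have x_y: "x m = y m" if "m \<in> dual_monoid (range w')" for m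
  proof -
    have "m \<in> dom y"
      unfolding dom_orbit[OF y(1)] using dual_monoid_antimono[OF sub] that by blast
    then show ?thesis using y(2) by (simp add: map_le_def)
  qed
  have "dual_monoid (range w') \<subseteq> dual_monoid H"
    using x_y' w'(2) dom_orbit[OF H(2)] by (force simp: dom_def)
  then have "H \<subseteq> range w'"
    using face_subset[OF F H(1) range_in_cones[OF w'(1)]] by blast
  then show "y' = y"
    using orbit_eqI[OF lb[OF w'(1)] _ sub H(2) y(1)] x_y x_y' by metis
qed

lemma dual_monoid_range_zero:
  assumes "lattice_basis w" "m \<in> dual_monoid (range w)"
  shows "(\<exists>g\<in>range w. pairing m g \<noteq> 0) \<longleftrightarrow> m \<noteq> 0"
  using eq_zero_if_pairing_basis_zero[OF assms(1), of m] by (auto simp: pairing_simps)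

lemma dom_fixed_point: "dom (fixed_point w) = dual_monoid (range w)"
  by (auto simp: fixed_point_def split: if_splits)

text \<open>The dual monoid of a full-dimensional cone has no unit except \<open>0\<close>, so a
  point of the orbit is zero at every other character.\<close>

lemma orbit_range:
  assumes lb: "lattice_basis (w :: 'd::finite \<Rightarrow> int ^ 'd)"
  shows "orbit (range w) = {fixed_point w :: ('d, 'k::field) tpoint}"
proof -
  have zero: "m = 0 \<and> m' = 0"
    if m: "m \<in> dual_monoid (range w)" "m' \<in> dual_monoid (range w)" and "m + m' = 0" for m m'
  proof -
    have "pairing m (w i) + pairing m' (w i) = 0" for i
      using that(3) by (metis pairing_add_left pairing_zero_left)
    moreover have "0 \<le> pairing m (w i)" "0 \<le> pairing m' (w i)" for i
      using m by (auto simp: dual_monoid_def)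
    ultimately have "pairing m (w i) = 0" for i
      by (smt (verit))
    then have "m = 0" by (rule eq_zero_if_pairing_basis_zero[OF lb])
    then show ?thesis using that(3) by simp
  qed
  let ?x = "fixed_point w :: ('d, 'k) tpoint"
  have "?x (m + m') = Some (the (?x m) * the (?x m'))"
    if m: "m \<in> dual_monoid (range w)" "m' \<in> dual_monoid (range w)" for m m'
    using m dual_monoid_add[OF m] zero[OF m] by (auto simp: fixed_point_def)
  moreover have "?x 0 = Some 1"
    by (simp add: fixed_point_def zero_in_dual_monoid)
  ultimately have "?x \<in> monoid_homs (dual_monoid (range w))"
    by (simp add: monoid_homs_def dom_fixed_point)
  then have "?x \<in> orbit (range w)"
    by (auto simp: orbit_def fixed_point_def pairing_simps)
  moreover have "x = ?x" if x: "x \<in> orbit (range w)" for x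
  proof
    fix m
    show "x m = ?x m"
      using orbit_zero_iff[OF x, of m] dual_monoid_range_zero[OF lb, of m] dom_orbit[OF x]
        monoid_homsD(2)[OF orbit_hom[OF x]] by (auto simp: fixed_point_def)
  qed
  ultimately show ?thesis by blast
qed

text \<open>For a cone kept by a blowing-up, this says that the blowing-up morphism does not move
  the points of its orbit.\<close>

lemma toric_map_id:
  assumes F: "regular_fan F" and G: "G \<in> cones F" and x: "x \<in> orbit G"
  shows "toric_map F x = x"
proof -
  obtain w where w: "w \<in> F" "G \<subseteq> range w" using G by (auto simp: cones_def)
  note lb = regular_fanD(1)[OF F w(1)]
  obtain z where z: "in_cone w z" "support w z = G"
    using ex_support_eq[OF lb w(2)] by blast
  show ?thesis
    by (rule toric_map_eqI[OF F w(1) z(1) dom_orbit[OF x]])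
      (use bidual[OF lb w(2), of z] z x in auto)
qed

text \<open>A criterion for contraction to the origin of a chart: the interior point
  \<open>z\<close> selects the cone of \<open>w\<close> as the target, and \<open>unit\<close> says
  that no nonzero character of the chart is invertible on the orbit.\<close>

lemma toric_map_fixed_point:
  fixes x :: "('d::finite, 'k::field) tpoint"
  assumes F: "regular_fan F" and w: "w \<in> F" and x: "x \<in> orbit G"
    and sub: "dual_monoid (range w) \<subseteq> dual_monoid G"
    and z: "in_cone w z" "support w z = range w" "\<And>m. m \<in> dual_monoid G \<Longrightarrow> 0 \<le> pairing m z"
    and unit: "\<And>m. m \<in> dual_monoid (range w) \<Longrightarrow> \<forall>g\<in>G. pairing m g = 0 \<Longrightarrow> m = 0"
  shows "toric_map F x = fixed_point w"
proof (rule toric_map_eqI[OF F w z(1) dom_orbit[OF x] z(3)])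
  show "(fixed_point w :: ('d, 'k) tpoint) \<in> orbit (support w z)"
    by (simp add: z(2) orbit_range[OF regular_fanD(1)[OF F w]])
  show "fixed_point w \<subseteq>\<^sub>m x"
    unfolding map_le_def dom_fixed_point
  proof
    fix m assume m: "m \<in> dual_monoid (range w)"
    show "fixed_point w m = x m"
    proof (cases "m = 0")
      case True
      then show ?thesis using monoid_homsD(2)[OF orbit_hom[OF x]] m by (simp add: fixed_point_def)
    next
      case False
      then have "x m = Some 0"
        using orbit_zero_iff[OF x, of m] unit[OF m] m sub by blast
      then show ?thesis using m False by (simp add: fixed_point_def)
    qed
  qed
qed

lemma toric_map_subcone:
  assumes F: "regular_fan F" and w: "w \<in> F" and lb': "lattice_basis w'"
    and sub: "dual_monoid (range w) \<subseteq> dual_monoid (range w')"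
  shows "toric_map F (fixed_point w' :: ('d::finite, 'k::field) tpoint) = fixed_point w"
proof -
  note lb = regular_fanD(1)[OF F w]
  let ?z = "\<Sum>i\<in>UNIV. w' i"
  have nonneg: "0 \<le> pairing (dual_basis w p) (w' i)" for p i
    using sub dual_basis_in_dual_monoid[OF lb order_refl, of p] by (auto simp: dual_monoid_def)
  \<comment> \<open>An interior point of a full-dimensional subcone is interior to the larger cone;
    otherwise some \<open>dual_basis w p\<close> would vanish on all of \<open>w'\<close>.\<close>
  have "pairing (dual_basis w p) ?z \<noteq> 0" for p
  proof
    assume "pairing (dual_basis w p) ?z = 0"
    then have "pairing (dual_basis w p) (w' i) = 0" for i
      using nonneg by (simp add: pairing_simps sum_nonneg_eq_0_iff)
    then have "dual_basis w p = 0"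
      by (rule eq_zero_if_pairing_basis_zero[OF lb'])
    then show False
      using pairing_dual_basis[OF lb, of p p] by (simp add: pairing_simps)
  qed
  then have "support w ?z = range w"
    by (simp add: support_def)
  moreover have "in_cone w ?z"
    using nonneg by (simp add: in_cone_def pairing_simps sum_nonneg)
  moreover have "0 \<le> pairing m ?z" if "m \<in> dual_monoid (range w')" for m
    using that by (auto simp: dual_monoid_def pairing_simps intro: sum_nonneg)
  moreover have "(fixed_point w' :: ('d, 'k) tpoint) \<in> orbit (range w')"
    by (simp add: orbit_range[OF lb'])
  ultimately show ?thesis
    using toric_map_fixed_point[OF F w _ sub] eq_zero_if_pairing_basis_zero[OF lb'] by blast
qed

section \<open>Torus-fixed points and the fibre over a blown-up point\<close>

lemma fixed_point_eq_iff:
  assumes F: "regular_fan F" and w: "w \<in> F" "w' \<in> F"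
  shows "fixed_point w = (fixed_point w' :: ('d::finite, 'k::field) tpoint) \<longleftrightarrow> w = w'"
proof
  assume "fixed_point w = (fixed_point w' :: ('d, 'k) tpoint)"
  then have "dual_monoid (range w) = dual_monoid (range w')"
    by (metis dom_fixed_point)
  then have "range w = range w'"
    using face_subset[OF F] range_in_cones w by (metis subset_antisym order_refl)
  then show "w = w'" using regular_fanD(2)[OF F] w by blast
qed simp

abbreviation star_subdivision where
  "star_subdivision F w \<equiv> F - {w} \<union> range (sub_basis w)"

lemma basis_of_fixed_point:
  assumes "regular_fan F" "w \<in> F"
  shows "basis_of_point F (fixed_point w :: ('d::finite, 'k::field) tpoint) = w"
  unfolding basis_of_point_def using assms fixed_point_eq_iff[OF assms(1)] by (intro the_equality) auto

lemma torus_fixed_imp_fixed_point: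
  assumes inf: "infinite (UNIV :: 'k set)" and F: "regular_fan F"
    and x: "torus_fixed F (x :: ('d::finite, 'k::field) tpoint)"
  shows "\<exists>w\<in>F. x = fixed_point w"
proof -
  obtain G where G: "G \<in> cones F" "x \<in> orbit G"
    using x toric_variety_eq[OF F] by (auto simp: torus_fixed_def)
  obtain w where w: "w \<in> F" "G \<subseteq> range w" using G by (auto simp: cones_def)
  note lb = regular_fanD(1)[OF F w(1)]
  have "\<not> (UNIV :: 'k set) \<subseteq> {0, 1}"
    using inf by (meson finite.emptyI finite.insertI finite_subset)
  then obtain c :: 'k where c: "c \<noteq> 0" "c \<noteq> 1" by blast
  have "w p \<in> G" for p
  proof (rule ccontr)
    assume p: "w p \<notin> G"
    let ?e = "dual_basis w p"
    \<comment> \<open>The value at \<open>c\<close> of the one-parameter subgroup of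
      \<open>w p\<close>. It multiplies \<open>x ?e\<close> by \<open>c\<close>, although this value
      is nonzero because \<open>?e\<close> is orthogonal to \<open>G\<close>.\<close>
    define t where "t m = c powi (pairing m (w p))" for m
    have "t \<in> torus"
      using c(1) by (simp add: torus_def t_def pairing_simps power_int_add)
    then have "torus_act t x = x"
      using x by (simp add: torus_fixed_def)
    then have "map_option (\<lambda>y. t ?e * y) (x ?e) = x ?e"
      by (metis torus_act_def)
    moreover have "t ?e = c"
      by (simp add: t_def pairing_dual_basis[OF lb])
    moreover have "x ?e \<noteq> None"
      using dom_orbit[OF G(2)] dual_basis_in_dual_monoid[OF lb w(2), of p] by auto
    ultimately have "x ?e = Some 0"
      using c(2) by auto
    moreover have "\<forall>g\<in>G. pairing ?e g = 0"
    proof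
      fix g assume "g \<in> G"
      then obtain q where "g = w q" "q \<noteq> p" using w(2) p by blast
      then show "pairing ?e g = 0" by (simp add: pairing_dual_basis[OF lb])
    qed
    ultimately show False
      using hom_unit[OF orbit_hom[OF G(2)]] by blast
  qed
  then have "G = range w" using w(2) by blast
  then have "x = fixed_point w" using G(2) orbit_range[OF lb] by blast
  then show ?thesis using w(1) by blast
qed

text \<open>The sum is the only new ray; without it, a face of a subcone is a face of the cone of
  \<open>w\<close>.\<close>

lemma cone_of_star_subdivision:
  assumes "G \<in> cones (star_subdivision F w)" "w \<in> F" "(\<Sum>i\<in>UNIV. w i) \<notin> G"
  shows "G \<in> cones F"
proof -
  obtain w' where w': "w' \<in> star_subdivision F w" "G \<subseteq> range w'"
    using assms(1) by (auto simp: cones_def)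
  show ?thesis
  proof (cases "w' \<in> F")
    case True
    then show ?thesis using w'(2) by (auto simp: cones_def)
  next
    case False
    then obtain a where "w' = sub_basis w a" using w'(1) by blast
    then have "G \<subseteq> insert (\<Sum>i\<in>UNIV. w i) (range w)"
      using w'(2) by (auto simp: sub_basis_def)
    then show ?thesis
      using assms(2,3) by (auto simp: cones_def)
  qed
qed

lemma toric_map_exceptional:
  assumes d: "CARD('d) \<ge> 2" and F: "regular_fan F" and w: "w \<in> F"
    and G: "G \<in> cones (star_subdivision F w)" "(\<Sum>i\<in>UNIV. w i) \<in> G"
    and x: "(x :: ('d::finite, 'k::field) tpoint) \<in> orbit G"
  shows "toric_map F x = fixed_point w"
proof -
  let ?s = "\<Sum>i\<in>UNIV. w i"
  note lb = regular_fanD(1)[OF F w]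
  obtain w' where w': "w' \<in> star_subdivision F w" "G \<subseteq> range w'"
    using G by (auto simp: cones_def)
  have F': "regular_fan (star_subdivision F w)"
    by (rule regular_fan_blowup[OF d F w])
  \<comment> \<open>The sum is interior to the cone of \<open>w\<close>, so it cannot be a generator
    of a cone kept from \<open>F\<close>.\<close>
  have "w' \<in> range (sub_basis w)"
  proof (rule ccontr)
    assume "w' \<notin> range (sub_basis w)"
    then have w'F: "w' \<in> F" "w' \<noteq> w" using w'(1) by auto
    obtain p where p: "?s = w' p" using G(2) w'(2) by auto
    have "in_cone w' ?s"
      unfolding p by (rule in_cone_basis[OF regular_fanD(1)[OF F w'F(1)]])
    then have "support w' ?s = range w"
      using regular_fanD(3)[OF F w w'F(1) in_cone_Sum[OF lb]] support_Sum[OF lb] by simp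
    moreover have "support w' ?s = {w' p}"
      unfolding p using regular_fanD(1)[OF F w'F(1)] by (auto simp: support_def pairing_dual_basis)
    ultimately have "range w = {w' p}" by simp
    then show False using card_range_basis[OF lb] d by simp
  qed
  then obtain a where a: "w' = sub_basis w a" by blast
  have "dual_monoid (range w) \<subseteq> dual_monoid G"
    using dual_monoid_subset_sub_basis[of w a] dual_monoid_antimono[OF w'(2)] a by blast
  moreover have "0 \<le> pairing m ?s" if "m \<in> dual_monoid G" for m
    using that G(2) by (simp add: dual_monoid_def)
  moreover have "m = 0" if m: "m \<in> dual_monoid (range w)" "\<forall>g\<in>G. pairing m g = 0" for m
  proof (rule eq_zero_if_pairing_basis_zero[OF lb])
    have "pairing m ?s = 0" using m(2) G(2) by blast
    then show "pairing m (w i) = 0" for i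
      using m(1) by (simp add: pairing_simps sum_nonneg_eq_0_iff dual_monoid_def)
  qed
  ultimately show ?thesis
    using toric_map_fixed_point[OF F w x _ in_cone_Sum[OF lb] support_Sum[OF lb]] by blast
qed

section \<open>Closures of toric divisors\<close>

text \<open>
  The union of the orbits of the cones that contain \<open>u\<close>. If \<open>u\<close> spans a ray of \<open>F\<close>, this is the
  torus-invariant prime divisor of that ray.
\<close>

definition divisor ::
  "int ^ 'd::finite \<Rightarrow> ('d \<Rightarrow> int ^ 'd) set \<Rightarrow> ('d, 'k::field) tpoint set" where
  "divisor u F = {x \<in> toric_variety F. \<forall>m\<in>dom x. 0 \<le> pairing m u}"

lemma eval_regular_single: "eval_regular (Poly_Mapping.single m 1) x = the (x m)"
  by (simp add: eval_regular_def)

lemma orbit_of_chart: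
  assumes F: "regular_fan F" and w: "w \<in> F" and x: "x \<in> chart F w"
  obtains G where "G \<in> cones F" "G \<subseteq> range w" "x \<in> orbit G"
proof -
  obtain G where G: "G \<in> cones F" "x \<in> orbit G"
    using x toric_variety_eq[OF F] by (auto simp: chart_def)
  moreover have "dual_monoid (range w) \<subseteq> dual_monoid G"
    using x dom_orbit[OF G(2)] by (simp add: chart_def)
  ultimately show ?thesis
    using face_subset[OF F G(1) range_in_cones[OF w]] that by blast
qed

text \<open>Local equations: in a chart whose cone contains \<open>u\<close>, all its characters
  positive on \<open>u\<close>; in any other chart the constant \<open>1\<close>, because the
  divisor misses it.\<close>

lemma zariski_closed_divisor:
  assumes F: "regular_fan F"
  shows "zariski_closed F (divisor u F :: ('d::finite, 'k::field) tpoint set)"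
  unfolding zariski_closed_def
proof (intro conjI ballI)
  fix w assume w: "w \<in> F"
  note lb = regular_fanD(1)[OF F w]
  let ?D = "divisor u F :: ('d, 'k) tpoint set"
  define I :: "(int ^ 'd \<Rightarrow>\<^sub>0 'k) set" where "I = (if in_cone w u
    then {Poly_Mapping.single m 1 | m. m \<in> dual_monoid (range w) \<and> 0 < pairing m u}
    else {Poly_Mapping.single 0 1})"
  have "Poly_Mapping.keys f \<subseteq> dual_monoid (range w)" if "f \<in> I" for f
    using that zero_in_dual_monoid by (auto simp: I_def split: if_splits)
  moreover have "x \<in> ?D \<longleftrightarrow> (\<forall>f\<in>I. eval_regular f x = 0)" if x: "x \<in> chart F w" for x
  proof -
    obtain G where G: "G \<in> cones F" "G \<subseteq> range w" "x \<in> orbit G"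
      using orbit_of_chart[OF F w x] .
    have xV: "x \<in> toric_variety F" and dom: "dual_monoid (range w) \<subseteq> dual_monoid G"
      using x dom_orbit[OF G(3)] by (auto simp: chart_def)
    have xD: "x \<in> ?D \<longleftrightarrow> (\<forall>m\<in>dual_monoid G. 0 \<le> pairing m u)"
      using xV dom_orbit[OF G(3)] by (simp add: divisor_def)
    show ?thesis
    proof (cases "in_cone w u")
      case False
      then have "\<not> (\<forall>m\<in>dual_monoid G. 0 \<le> pairing m u)"
        using in_cone_iff[OF lb] dom by blast
      moreover have "x 0 = Some 1"
        using monoid_homsD(2)[OF orbit_hom[OF G(3)]] .
      ultimately show ?thesis
        using False by (simp add: xD I_def eval_regular_single[of 0, simplified])
    next
      case True
      have x_zero: "x m = Some 0 \<longleftrightarrow> the (x m) = 0" if "m \<in> dual_monoid (range w)" for m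
        using that dom dom_orbit[OF G(3)] by force
      have I: "(\<forall>f\<in>I. eval_regular f x = 0) \<longleftrightarrow>
          (\<forall>m\<in>dual_monoid (range w). 0 < pairing m u \<longrightarrow> x m = Some 0)"
        using True by (auto simp: I_def eval_regular_single x_zero)
      show ?thesis
        unfolding xD I
      proof (intro iffI ballI impI)
        fix m assume *: "\<forall>m\<in>dual_monoid G. 0 \<le> pairing m u"
          and m: "m \<in> dual_monoid (range w)" "0 < pairing m u"
        show "x m = Some 0"
        proof (rule ccontr)
          assume "x m \<noteq> Some 0"
          then have "- m \<in> dual_monoid G"
            using orbit_zero_iff[OF G(3), of m] m dom by (auto simp: dual_monoid_def pairing_simps)
          then show False using * m(2) by (auto simp: pairing_simps)
        qed
      next
        assume *: "\<forall>m\<in>dual_monoid (range w). 0 < pairing m u \<longrightarrow> x m = Some 0"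
        \<comment> \<open>A coordinate \<open>dual_basis w p\<close> positive on \<open>u\<close>
          vanishes at \<open>x\<close>, which forces \<open>w p\<close> into
          \<open>G\<close>.\<close>
        have "support w u \<subseteq> G"
        proof
          fix g assume "g \<in> support w u"
          then obtain p where p: "g = w p" "pairing (dual_basis w p) u \<noteq> 0"
            by (auto simp: support_def)
          then have "0 < pairing (dual_basis w p) u"
            using True by (simp add: in_cone_def order_le_neq_trans)
          moreover have e: "dual_basis w p \<in> dual_monoid (range w)"
            by (rule dual_basis_in_dual_monoid[OF lb order_refl])
          ultimately have "x (dual_basis w p) = Some 0" using * by blast
          then obtain h where h: "h \<in> G" "pairing (dual_basis w p) h \<noteq> 0"
            using orbit_zero_iff[OF G(3)] e dom by blast
          then obtain q where "h = w q" using G(2) by blast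
          then have "h = g"
            using h(2) p(1) pairing_dual_basis[OF lb, of p q] by (simp split: if_splits)
          then show "g \<in> G" using h(1) by simp
        qed
        then show "0 \<le> pairing m u" if "m \<in> dual_monoid G" for m
          using bidual[OF lb G(2)] True that by blast
      qed
    qed
  qed
  ultimately show "\<exists>I. (\<forall>f\<in>I. Poly_Mapping.keys f \<subseteq> dual_monoid (range w)) \<and>
      ?D \<inter> chart F w = {x \<in> chart F w. \<forall>f\<in>I. eval_regular f x = 0}"
    by (intro exI[of _ I]) blast
qed (auto simp: divisor_def)

lemma eval_regular_fixed_point:
  assumes "Poly_Mapping.keys f \<subseteq> dual_monoid (range w)"
  shows "eval_regular f (fixed_point w) = Poly_Mapping.lookup f 0"
proof -
  have "eval_regular f (fixed_point w)
      = (\<Sum>m\<in>Poly_Mapping.keys f. if m = 0 then Poly_Mapping.lookup f 0 else 0)"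
    unfolding eval_regular_def using assms by (intro sum.cong) (auto simp: fixed_point_def)
  then show ?thesis
    by (simp add: in_keys_iff)
qed

text \<open>
  A curve in the orbit of the ray \<open>w p\<close> that tends to the fixed point of \<open>w\<close> as \<open>c\<close> tends to \<open>0\<close>. A regular
  function is a polynomial in \<open>c\<close> along it, with constant term the value at the fixed point.
\<close>

definition curve_point :: "('d::finite \<Rightarrow> int ^ 'd) \<Rightarrow> 'd \<Rightarrow> 'k::field \<Rightarrow> ('d, 'k) tpoint" where
  "curve_point w p c = (\<lambda>m. if pairing m (w p) < 0 then None
     else Some (if pairing m (w p) = 0 then c powi (\<Sum>i\<in>UNIV. pairing m (w i)) else 0))"

lemma curve_point_in_orbit:
  assumes "c \<noteq> 0"
  shows "curve_point w p c \<in> orbit {w p}"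
  using assms
  by (auto simp: orbit_def monoid_homs_def curve_point_def dual_monoid_def pairing_simps
      sum.distrib power_int_add split: if_splits)

text \<open>An equation of a closed set containing the orbit restricts to a polynomial in
  \<open>c\<close> with infinitely many roots.\<close>

lemma fixed_point_in_closure:
  assumes inf: "infinite (UNIV :: 'k set)" and F: "regular_fan F" and w: "w \<in> F"
    and A: "orbit {w p} \<subseteq> (A :: ('d::finite, 'k::field) tpoint set)"
  shows "fixed_point w \<in> zariski_closure F A"
  unfolding zariski_closure_def
proof (intro InterI, clarify)
  note lb = regular_fanD(1)[OF F w]
  fix Z :: "('d, 'k) tpoint set" assume Z: "zariski_closed F Z" "A \<subseteq> Z"
  then obtain I where I: "\<forall>f\<in>I. Poly_Mapping.keys f \<subseteq> dual_monoid (range w)"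
    "Z \<inter> chart F w = {x \<in> chart F w. \<forall>f\<in>I. eval_regular f x = 0}"
    using w unfolding zariski_closed_def by blast
  have chart: "x \<in> chart F w" if "x \<in> orbit G" "G \<subseteq> range w" for G and x :: "('d, 'k) tpoint"
    using that w dual_monoid_antimono[OF that(2)] dom_orbit[OF that(1)]
    by (auto simp: chart_def toric_variety_eq[OF F] cones_def)
  have "eval_regular f (fixed_point w) = 0" if f: "f \<in> I" for f
  proof -
    let ?K = "{m \<in> Poly_Mapping.keys f. pairing m (w p) = 0}"
    let ?E = "\<lambda>m. nat (\<Sum>i\<in>UNIV. pairing m (w i))"
    \<comment> \<open>Only characters orthogonal to \<open>w p\<close> survive on the curve. Their
      exponents are nonnegative since \<open>f\<close> is regular on the chart, so
      \<open>nat\<close> loses nothing.\<close>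
    define q where "q = (\<Sum>m\<in>?K. monom (Poly_Mapping.lookup f m) (?E m))"
    have keys: "0 \<le> pairing m (w i)" if "m \<in> Poly_Mapping.keys f" for m i
      using I(1) f that by (auto simp: dual_monoid_def)
    have "poly q c = 0" if c: "c \<noteq> 0" for c
    proof -
      have "curve_point w p c \<in> Z \<inter> chart F w"
        using curve_point_in_orbit[OF c] A Z(2) chart[of _ "{w p}"] by blast
      then have "0 = eval_regular f (curve_point w p c)"
        using I(2) f by force
      also have "\<dots> = (\<Sum>m\<in>Poly_Mapping.keys f. if pairing m (w p) = 0
          then Poly_Mapping.lookup f m * c ^ ?E m else 0)"
        unfolding eval_regular_def
      proof (rule sum.cong)
        fix m assume m: "m \<in> Poly_Mapping.keys f"
        have "0 \<le> (\<Sum>i\<in>UNIV. pairing m (w i))"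
          using keys[OF m] by (simp add: sum_nonneg)
        then show "Poly_Mapping.lookup f m * the (curve_point w p c m) =
            (if pairing m (w p) = 0 then Poly_Mapping.lookup f m * c ^ ?E m else 0)"
          using keys[OF m, of p] by (simp add: curve_point_def power_int_def)
      qed simp
      also have "\<dots> = poly q c"
        unfolding q_def poly_sum poly_monom by (simp add: sum.inter_filter)
      finally show ?thesis by simp
    qed
    then have "UNIV - {0} \<subseteq> {c. poly q c = 0}" by blast
    then have "infinite {c. poly q c = 0}"
      using inf by (meson finite.emptyI finite_Diff2 finite_insert finite_subset)
    then have "q = 0" using poly_roots_finite by blast
    then have "0 = coeff q 0" by simp
    \<comment> \<open>An exponent is a sum of nonnegative pairings with a basis, so only
      \<open>m = 0\<close> contributes to the constant term.\<close>
    also have "\<dots> = (\<Sum>m\<in>?K. if m = 0 then Poly_Mapping.lookup f 0 else 0)"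
      unfolding q_def coeff_sum coeff_monom
    proof (rule sum.cong)
      fix m assume "m \<in> ?K"
      then have m: "m \<in> Poly_Mapping.keys f" by simp
      have "?E m = 0 \<longleftrightarrow> (\<Sum>i\<in>UNIV. pairing m (w i)) = 0"
        using sum_nonneg[of UNIV "\<lambda>i. pairing m (w i)", OF keys[OF m]] by linarith
      also have "\<dots> \<longleftrightarrow> (\<forall>i. pairing m (w i) = 0)"
        using keys[OF m] by (simp add: sum_nonneg_eq_0_iff)
      also have "\<dots> \<longleftrightarrow> m = 0"
        using eq_zero_if_pairing_basis_zero[OF lb] by (auto simp: pairing_simps)
      finally show "(if ?E m = 0 then Poly_Mapping.lookup f m else 0)
          = (if m = 0 then Poly_Mapping.lookup f 0 else 0)" by simp
    qed simp
    also have "\<dots> = Poly_Mapping.lookup f 0"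
      by (simp add: in_keys_iff pairing_simps)
    also have "\<dots> = eval_regular f (fixed_point w)"
      using eval_regular_fixed_point I(1) f by metis
    finally show ?thesis by simp
  qed
  moreover have "(fixed_point w :: ('d, 'k) tpoint) \<in> chart F w"
    using chart[of _ "range w"] by (simp add: orbit_range[OF lb])
  ultimately show "fixed_point w \<in> Z" using I(2) by blast
qed

lemma zariski_closure_superset: "A \<subseteq> zariski_closure F A"
  by (auto simp: zariski_closure_def)

lemma zariski_closure_least: "zariski_closed F Z \<Longrightarrow> A \<subseteq> Z \<Longrightarrow> zariski_closure F A \<subseteq> Z"
  by (auto simp: zariski_closure_def)

section \<open>Constellations\<close>

lemma ray_star_subdivision:
  assumes d: "CARD('d::finite) \<ge> 2" and u: "{u :: int ^ 'd} \<in> cones F"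
  shows "{u} \<in> cones (star_subdivision F w)"
proof -
  obtain w' where w': "w' \<in> F" "u \<in> range w'" using u by (auto simp: cones_def)
  show ?thesis
  proof (cases "w' = w")
    case True
    then obtain p where p: "u = w p" using w' by blast
    \<comment> \<open>Subdividing at another position keeps \<open>u\<close> as a generator.\<close>
    obtain a where "a \<noteq> p" using ex_other_index[OF d] by blast
    then have "u = sub_basis w a p" by (simp add: sub_basis_def p)
    then have "{u} \<subseteq> range (sub_basis w a)" by simp
    then show ?thesis unfolding cones_def by blast
  next
    case False
    then show ?thesis using w' by (auto simp: cones_def)
  qed
qed

lemma Sum_ray_star_subdivision: "{\<Sum>i\<in>UNIV. w i} \<in> cones (star_subdivision F w)"
proof -
  have "{\<Sum>i\<in>UNIV. w i} \<subseteq> range (sub_basis w a)" for a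
    by (auto simp: sub_basis_def image_iff)
  then show ?thesis unfolding cones_def by blast
qed

text \<open>\<open>blowup_fan\<close> recovers the basis of the centre through a \<open>THE\<close>,
  which regularity of the fan makes meaningful; regularity in turn comes from the preceding star
  subdivision, so one induction carries both.\<close>

lemma constellation_step:
  fixes Q :: "nat \<Rightarrow> ('d::finite, 'k::field) tpoint"
  assumes d: "CARD('d) \<ge> 2" and inf: "infinite (UNIV :: 'k set)" and v: "lattice_basis v"
    and C: "toric_constellation v n Q" and i: "i \<le> n"
  shows "regular_fan (fan v Q i) \<and> (\<exists>w\<in>fan v Q i. Q i = fixed_point w \<and>
    fan v Q (Suc i) = star_subdivision (fan v Q i) w)"
  using i
proof (induction i)
  case 0
  have F: "regular_fan (fan v Q 0)"
    using v by (simp add: regular_fan_def)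
  moreover obtain w where "w \<in> fan v Q 0" "Q 0 = fixed_point w"
    using torus_fixed_imp_fixed_point[OF inf F] C 0 by (auto simp: toric_constellation_def)
  ultimately show ?case
    using basis_of_fixed_point[OF F] by (metis blowup_fan_def fan.simps(2))
next
  case (Suc i)
  then obtain w where w: "regular_fan (fan v Q i)" "w \<in> fan v Q i"
    "fan v Q (Suc i) = star_subdivision (fan v Q i) w" by auto
  have F: "regular_fan (fan v Q (Suc i))"
    unfolding w(3) by (rule regular_fan_blowup[OF d w(1,2)])
  moreover obtain w where "w \<in> fan v Q (Suc i)" "Q (Suc i) = fixed_point w"
    using torus_fixed_imp_fixed_point[OF inf F] C Suc.prems unfolding toric_constellation_def by blast
  ultimately show ?case
    using basis_of_fixed_point[OF F] by (metis blowup_fan_def fan.simps(2))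
qed

text \<open>Each blowing-up replaces a cone by subcones. This serves to exclude that a point coded
  from \<open>Q i\<close> occurs at stage \<open>i\<close> or earlier.\<close>

lemma fan_refines:
  fixes Q :: "nat \<Rightarrow> ('d::finite, 'k::field) tpoint"
  assumes d: "CARD('d) \<ge> 2" and inf: "infinite (UNIV :: 'k set)" and v: "lattice_basis v"
    and C: "toric_constellation v n Q" and ji: "j \<le> i" and i: "i \<le> n" and w: "w \<in> fan v Q i"
  shows "\<exists>w'\<in>fan v Q j. dual_monoid (range w') \<subseteq> dual_monoid (range w)"
  using ji i w
proof (induction i arbitrary: w rule: dec_induct)
  case base
  then show ?case by blast
next
  case (step i)
  then have "i \<le> n" by simp
  then obtain w0 where w0: "regular_fan (fan v Q i)" "w0 \<in> fan v Q i"
    "fan v Q (Suc i) = star_subdivision (fan v Q i) w0"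
    using constellation_step[OF d inf v C] by blast
  then obtain w1 where w1: "w1 \<in> fan v Q i" "dual_monoid (range w1) \<subseteq> dual_monoid (range w)"
    using step.prems(2) dual_monoid_subset_sub_basis[of w0] by blast
  show ?case
    using step.IH[OF \<open>i \<le> n\<close> w1(1)] w1(2) by blast
qed

text \<open>The orbit survives because \<open>{u}\<close> stays a cone and the later centres have
  maximal cones; the divisor stays an upper bound because it is closed. The fixed points come from
  the exceptional fibre for \<open>k = 0\<close> and from the closure afterwards.\<close>

lemma strict_transform_bounds:
  fixes Q :: "nat \<Rightarrow> ('d::finite, 'k::field) tpoint"
  assumes d: "CARD('d) \<ge> 2" and inf: "infinite (UNIV :: 'k set)" and v: "lattice_basis v"
    and C: "toric_constellation v n Q" and w: "w \<in> fan v Q i" "Q i = fixed_point w"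
    and k: "i + k \<le> n"
  defines "u \<equiv> \<Sum>p\<in>UNIV. w p"
  shows "{u} \<in> cones (fan v Q (Suc (i + k))) \<and> orbit {u} \<subseteq> strict_transform v Q i k \<and>
    strict_transform v Q i k \<subseteq> divisor u (fan v Q (Suc (i + k))) \<and>
    (\<forall>w'\<in>fan v Q (Suc (i + k)). u \<in> range w' \<longrightarrow> fixed_point w' \<in> strict_transform v Q i k)"
  using k
proof (induction k)
  case 0
  then have i: "i \<le> n" by simp
  let ?F = "fan v Q i" and ?F' = "fan v Q (Suc i)"
  have F: "regular_fan ?F" using constellation_step[OF d inf v C i] by blast
  have F'_eq: "?F' = star_subdivision ?F w"
    using constellation_step[OF d inf v C i] w fixed_point_eq_iff[OF F] by metis
  have F': "regular_fan ?F'"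
    unfolding F'_eq by (rule regular_fan_blowup[OF d F w(1)])
  have ray: "{u} \<in> cones ?F'"
    unfolding F'_eq u_def by (rule Sum_ray_star_subdivision)
  have mem: "x \<in> strict_transform v Q i 0" if "x \<in> orbit G" "G \<in> cones ?F'" "u \<in> G" for x G
    using toric_map_exceptional[OF d F w(1) _ _ that(1)] that toric_variety_eq[OF F'] w(2)
    by (auto simp: F'_eq u_def simp del: fan.simps)
  have "x \<in> divisor u ?F'" if x: "x \<in> strict_transform v Q i 0" for x
  proof -
    have xV: "x \<in> toric_variety ?F'" and tm: "toric_map ?F x = Q i"
      using x by auto
    obtain G where G: "G \<in> cones ?F'" "x \<in> orbit G"
      using xV toric_variety_eq[OF F'] by blast
    have "0 \<le> pairing m u" if m: "m \<in> dom x" for m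
    proof (cases "u \<in> G")
      case True
      then show ?thesis using m dom_orbit[OF G(2)] by (simp add: dual_monoid_def)
    next
      case False
      \<comment> \<open>Such a point is not moved, so it could only be \<open>Q i\<close> itself,
        and the characters in its domain are nonnegative on the sum \<open>u\<close>.\<close>
      then have "toric_map ?F x = x"
        using toric_map_id[OF F cone_of_star_subdivision G(2)] G(1) w(1) F'_eq u_def by metis
      then have "dom x = dual_monoid (range w)"
        using tm w(2) dom_fixed_point by metis
      then show ?thesis
        using m by (auto simp: dual_monoid_def u_def pairing_simps intro: sum_nonneg)
    qed
    then show ?thesis using xV by (simp add: divisor_def)
  qed
  moreover have "fixed_point w' \<in> strict_transform v Q i 0" if "w' \<in> ?F'" "u \<in> range w'" for w'
    using mem[OF _ range_in_cones[OF that(1)] that(2)] orbit_range[OF regular_fanD(1)[OF F' that(1)]]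
    by blast
  ultimately show ?case
    using ray mem[of _ "{u}"] by auto
next
  case (Suc k)
  let ?i = "Suc (i + k)"
  let ?F = "fan v Q ?i" and ?F' = "fan v Q (Suc ?i)" and ?S = "strict_transform v Q i k"
  have i: "?i \<le> n" using Suc.prems by simp
  have IH: "{u} \<in> cones ?F" "orbit {u} \<subseteq> ?S" "?S \<subseteq> divisor u ?F"
    using Suc by auto
  obtain w1 where F: "regular_fan ?F" and w1: "w1 \<in> ?F" "Q ?i = fixed_point w1"
    and F'_eq: "?F' = star_subdivision ?F w1"
    using constellation_step[OF d inf v C i] by blast
  have F': "regular_fan ?F'"
    unfolding F'_eq by (rule regular_fan_blowup[OF d F w1(1)])
  have ray: "{u} \<in> cones ?F'"
    unfolding F'_eq by (rule ray_star_subdivision[OF d IH(1)])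
  define A where "A = {x \<in> toric_variety ?F'. toric_map ?F x \<in> ?S - {Q ?i}}"
  have S: "strict_transform v Q i (Suc k) = zariski_closure ?F' A"
    by (simp add: A_def)
  have orbit_A: "orbit {u} \<subseteq> A"
  proof
    fix x :: "('d, 'k) tpoint" assume x: "x \<in> orbit {u}"
    \<comment> \<open>The cone of the centre has at least two generators.\<close>
    have "x \<noteq> Q ?i"
    proof
      assume "x = Q ?i"
      then have "dual_monoid {u} = dual_monoid (range w1)"
        using w1(2) dom_orbit[OF x] dom_fixed_point by metis
      then have "range w1 = {u}"
        using face_subset[OF F] IH(1) range_in_cones[OF w1(1)] by (metis subset_antisym order_refl)
      then show False
        using card_range_basis[OF regular_fanD(1)[OF F w1(1)]] d by simp
    qed
    then show "x \<in> A"
      using x IH(2) toric_map_id[OF F IH(1) x] ray toric_variety_eq[OF F'] by (auto simp: A_def)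
  qed
  have "A \<subseteq> divisor u ?F'"
  proof
    fix x assume x: "x \<in> A"
    then obtain G where G: "G \<in> cones ?F'" "x \<in> orbit G"
      using toric_variety_eq[OF F'] by (auto simp: A_def)
    \<comment> \<open>A point whose cone contains the new ray maps to the centre, which is removed
      in \<open>A\<close>.\<close>
    have "(\<Sum>p\<in>UNIV. w1 p) \<notin> G"
      using toric_map_exceptional[OF d F w1(1) _ _ G(2)] G(1) x w1(2)
      by (auto simp: A_def F'_eq simp del: fan.simps)
    then have "toric_map ?F x = x"
      using toric_map_id[OF F cone_of_star_subdivision G(2)] G(1) w1(1) F'_eq by metis
    then show "x \<in> divisor u ?F'"
      using x IH(3) by (auto simp: A_def divisor_def)
  qed
  then have "strict_transform v Q i (Suc k) \<subseteq> divisor u ?F'"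
    unfolding S by (rule zariski_closure_least[OF zariski_closed_divisor[OF F']])
  moreover have "fixed_point w' \<in> strict_transform v Q i (Suc k)"
    if "w' \<in> ?F'" "u \<in> range w'" for w'
    using that fixed_point_in_closure[OF inf F' that(1)] orbit_A unfolding S by blast
  moreover have "orbit {u} \<subseteq> strict_transform v Q i (Suc k)"
    unfolding S using orbit_A zariski_closure_superset by blast
  ultimately show ?case
    using ray by (simp del: strict_transform.simps fan.simps)
qed

section \<open>Codes as iterated subdivisions\<close>

lemma lattice_basis_foldl: "lattice_basis w \<Longrightarrow> lattice_basis (foldl sub_basis w as)"
  by (induction as arbitrary: w) (simp_all add: lattice_basis_sub_basis)

lemma dual_monoid_subset_foldl:
  "dual_monoid (range w) \<subseteq> dual_monoid (range (foldl sub_basis w as))"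
  by (induction as arbitrary: w) (simp, use dual_monoid_subset_sub_basis in force)

lemma foldl_sub_basis_other: "p \<notin> set as \<Longrightarrow> foldl sub_basis w as p = w p"
  by (induction as arbitrary: w) (auto simp: sub_basis_def)

text \<open>On the subcone the \<open>p\<close>-th coordinate is minimal, so coordinate
  \<open>b\<close> minus coordinate \<open>p\<close> is nonnegative there, while it equals
  \<open>- 1\<close> at \<open>w p\<close>.\<close>

lemma separate_sub_basis:
  assumes d: "CARD('d::finite) \<ge> 2" and lb: "lattice_basis (w :: 'd \<Rightarrow> int ^ 'd)"
  shows "\<exists>m\<in>dual_monoid (range (sub_basis w p)). pairing m (w p) < 0"
proof -
  obtain b where b: "b \<noteq> p" using ex_other_index[OF d] by blast
  let ?m = "dual_basis w b - dual_basis w p"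
  have "?m \<in> dual_monoid (range (sub_basis w p))"
    using b by (auto simp: dual_monoid_def range_sub_basis pairing_diff_left
        pairing_dual_basis_Sum[OF lb] pairing_dual_basis[OF lb])
  moreover have "pairing ?m (w p) < 0"
    using b by (simp add: pairing_diff_left pairing_dual_basis[OF lb])
  ultimately show ?thesis by blast
qed

text \<open>At the first occurrence of \<open>p\<close> the vector at that position is still
  \<open>w p\<close>; later subdivisions only enlarge the dual monoid, so the separating character
  persists.\<close>

lemma separate_foldl_sub_basis:
  assumes d: "CARD('d::finite) \<ge> 2" and lb: "lattice_basis (w :: 'd \<Rightarrow> int ^ 'd)"
    and p: "p \<in> set as"
  shows "\<exists>m\<in>dual_monoid (range (foldl sub_basis w as)). pairing m (w p) < 0"
proof -
  obtain ys zs where as: "as = ys @ p # zs" "p \<notin> set ys"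
    using split_list_first[OF p] by blast
  let ?w = "foldl sub_basis w ys"
  have lb': "lattice_basis ?w" by (rule lattice_basis_foldl[OF lb])
  have "dual_monoid (range (sub_basis ?w p)) \<subseteq> dual_monoid (range (foldl sub_basis w as))"
    using dual_monoid_subset_foldl[of "sub_basis ?w p" zs] as by simp
  moreover obtain m where "m \<in> dual_monoid (range (sub_basis ?w p))" "pairing m (?w p) < 0"
    using separate_sub_basis[OF d lb'] by blast
  ultimately show ?thesis
    using foldl_sub_basis_other[OF as(2), of w] by auto
qed

theorem proposition2p10:
  fixes v :: "'d::finite \<Rightarrow> int ^ 'd"
    and Q :: "nat \<Rightarrow> ('d, 'k::field) tpoint"
    and n i j k :: nat
    and a :: "nat \<Rightarrow> 'd"
  assumes "CARD('d) \<ge> 2"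
    and "infinite (UNIV :: 'k set)"
    and "lattice_basis v"
    and "toric_constellation v n Q"
    and "i \<le> n" and "j \<le> n"
    and "k \<ge> 1"
    and "Q j = coded_point (fan v Q i) (Q i) (map a [1..<k + 1])"
  shows "proximate v Q j i \<longleftrightarrow> (\<forall>l\<in>{2..k}. a 1 \<noteq> a l)"
proof -
  note step = constellation_step[OF assms(1-4)]
  obtain w where Fi: "regular_fan (fan v Q i)" and w: "w \<in> fan v Q i" "Q i = fixed_point w"
    using step[OF assms(5)] by blast
  obtain w2 where Fj: "regular_fan (fan v Q j)" and w2: "w2 \<in> fan v Q j" "Q j = fixed_point w2"
    using step[OF assms(6)] by blast
  note lb = regular_fanD(1)[OF Fi w(1)] and lb2 = regular_fanD(1)[OF Fj w2(1)]
  \<comment> \<open>\<open>as\<close> holds the letters after the first and is empty for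
    \<open>k = 1\<close>.\<close>
  define w1 as where "w1 = sub_basis w (a 1)" and "as = map a [2..<k + 1]"
  define w' where "w' = foldl sub_basis w1 as"
  define u where "u = (\<Sum>p\<in>UNIV. w p)"
  have lb1: "lattice_basis w1"
    unfolding w1_def by (rule lattice_basis_sub_basis[OF lb])
  have w1_u: "w1 (a 1) = u" by (simp add: w1_def u_def sub_basis_def)
  have lb': "lattice_basis w'"
    unfolding w'_def by (rule lattice_basis_foldl[OF lb1])
  have "map a [1..<k + 1] = a 1 # as"
    using assms(7) by (simp add: as_def upt_conv_Cons numeral_2_eq_2 del: upt_Suc)
  then have Qj: "Q j = fixed_point w'"
    using assms(8) by (simp add: coded_point_def w(2) basis_of_fixed_point[OF Fi w(1)] w'_def w1_def)
  \<comment> \<open>\<open>w'\<close> comes from the code and \<open>w2\<close> from the fan. They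
    are compared only through the domain of their common fixed point, and facts about the fan are
    applied to \<open>w2\<close>.\<close>
  have dual_eq: "dual_monoid (range w2) = dual_monoid (range w')"
    using Qj w2(2) dom_fixed_point by metis
  have sub1: "dual_monoid (range w1) \<subseteq> dual_monoid (range w')"
    unfolding w'_def by (rule dual_monoid_subset_foldl)
  have sub: "dual_monoid (range w) \<subseteq> dual_monoid (range w1)"
    unfolding w1_def by (rule dual_monoid_subset_sub_basis)
  \<comment> \<open>The order of the stages is forced by the code. At stage \<open>i\<close> or
    earlier, \<open>Q j\<close> would have a maximal cone containing that of \<open>Q i\<close>,
    whereas the first letter puts its cone inside a proper subcone.\<close>
  have "i < j"
  proof (rule ccontr)
    assume "\<not> i < j"
    then obtain w0 where w0: "w0 \<in> fan v Q j" "dual_monoid (range w0) \<subseteq> dual_monoid (range w)"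
      using fan_refines[OF assms(1-4) _ assms(5) w(1), of j] by auto
    then have "range w2 \<subseteq> range w0"
      using face_subset[OF Fj range_in_cones[OF w2(1)] range_in_cones[OF w0(1)]] sub sub1 dual_eq
      by blast
    then have "range w2 = range w0"
      using card_range_basis[OF lb2] card_range_basis[OF regular_fanD(1)[OF Fj w0(1)]]
      by (intro card_subset_eq) auto
    then have "dual_monoid (range w1) \<subseteq> dual_monoid (range w)"
      using w0(2) sub1 dual_eq by simp
    moreover obtain m where "m \<in> dual_monoid (range w1)" "pairing m (w (a 1)) < 0"
      using separate_sub_basis[OF assms(1) lb] unfolding w1_def by blast
    ultimately have "m \<in> dual_monoid (range w)" "pairing m (w (a 1)) < 0"
      by blast+
    then show False
      by (simp add: dual_monoid_def) (metis not_le)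
  qed
  have tm: "toric_map (fan v Q i) (Q j) = Q i"
    unfolding Qj w(2) using toric_map_subcone[OF Fi w(1) lb'] sub sub1 by blast
  \<comment> \<open>\<open>l\<close> counts the blowing-ups between the one at \<open>Q i\<close>
    and stage \<open>j\<close>; for \<open>l = 0\<close> the transform is the exceptional divisor
    itself.\<close>
  define l where "l = j - Suc i"
  have l: "Suc (i + l) = j" "i + l \<le> n"
    using \<open>i < j\<close> assms(6) by (auto simp: l_def)
  note st = strict_transform_bounds[OF assms(1-4) w l(2), folded u_def, unfolded l(1)]
  have "Q j \<in> strict_transform v Q i l \<longleftrightarrow> a 1 \<notin> set as"
  proof
    assume "Q j \<in> strict_transform v Q i l"
    then have "Q j \<in> divisor u (fan v Q j)"
      using st by blast
    moreover have "dom (Q j) = dual_monoid (range w')"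
      unfolding Qj by (rule dom_fixed_point)
    ultimately have "\<forall>m\<in>dual_monoid (range w'). 0 \<le> pairing m u"
      by (simp add: divisor_def)
    then show "a 1 \<notin> set as"
      using separate_foldl_sub_basis[OF assms(1) lb1, of "a 1" as] unfolding w1_u w'_def by force
  next
    assume "a 1 \<notin> set as"
    then have "w' (a 1) = u"
      unfolding w'_def using foldl_sub_basis_other w1_u by metis
    then have "dual_monoid (range w2) \<subseteq> dual_monoid {u}"
      unfolding dual_eq by (intro dual_monoid_antimono) auto
    \<comment> \<open>Since \<open>{u}\<close> is a cone of the fan at stage \<open>j\<close>,
      containment of cones becomes containment of generators.\<close>
    then have "u \<in> range w2"
      using face_subset[OF Fj _ range_in_cones[OF w2(1)]] st by blast
    then show "Q j \<in> strict_transform v Q i l"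
      using st w2 by auto
  qed
  moreover have "a 1 \<notin> set as \<longleftrightarrow> (\<forall>l\<in>{2..k}. a 1 \<noteq> a l)"
    by (auto simp: as_def)
  ultimately show ?thesis
    using \<open>i < j\<close> tm by (simp add: proximate_def l_def)
qed

end
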